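(* Let $(g,\mu,J)$ be a driven cofactor system in adapted coordinates $(y^i,x^a)$, with $J$ and $J_1$ nonsingular. Let $g_2=g_{ab}(x)\,dx^a\otimes dx^b$, let $\bar J_2$ be the type $(1,1)$ tensor with components $\bar J_2{}^a_b=J^a_b-J^a_i(J_1^{-1})^i_jJ^j_b$, and put $$\bar\mu_2=P_2(dW_{(n)})=\frac{\partial W_{(n)}}{\partial x^a}\,dx^a .$$ Then the triple $(g_2,\bar\mu_2,\bar J_2)$ determines a cofactor system parametrically depending on the coordinates $y^i$ of the driving system; i.e. for each fixed $y$ it is a cofactor system on the space of the $x^a$.
   Context: Everything is smooth and the summation convention is used; coordinate domains are taken such that closed 1-forms are exact. Special conformal Killing tensor (scKt) for a Riemannian metric $g$: a type $(1,1)$ tensor field $J$, symmetric with respect to $g$, with $J_{\alpha\beta|\gamma}=\frac12(\alpha_\alpha g_{\beta\gamma}+\alpha_\beta g_{\alpha\gamma})$, where $J_{\alpha\beta}=g_{\alpha\gamma}J^\gamma_\beta$, the bar is the Levi-Civita covariant derivative of $g$, and (necessarily) $\alpha=d(\operatorname{tr}J)$. The cofactor tensor $\operatorname{cof}J$ is defined by $J(\operatorname{cof}J)=(\operatorname{cof}J)J=(\det J)I$ (in general: the adjugate). $J$ acts on 1-forms by its adjoint. $d_J$ is the degree 1 derivation of forms anticommuting with $d$ with $d_Jf=J(df)$ on functions, and $D_J\rho=d_J\rho+d(\operatorname{tr}J)\wedge\rho$. A cofactor system $(g,\mu,J)$ consists of a Riemannian metric $g$, a 1-form $\mu$ and a nonsingular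 scKt $J$ for $g$ with $D_J\mu=0$ (locally equivalent to $(\operatorname{cof}J)\mu$ being exact). Driven cofactor system in adapted coordinates: a cofactor system on a manifold of dimension $N=m+n$ with coordinates $(y^i,x^a)$, $i=1,\dots,m$, $a=1,\dots,n$, such that $g=g_{ij}(y)dy^i\otimes dy^j+g_{ab}(x)dx^a\otimes dx^b$ (no mixed terms) and $\mu=\mu_1+\mu_2$ with $\mu_1=Q_i(y)dy^i$, $\mu_2=Q_a(x,y)dx^a$, $Q_a=-\partial V/\partial x^a$ for a function $V(x,y)$, and the $\partial Q_a/\partial y^i$ are not all zero. $K=\mathrm{span}\{\partial/\partial x^a\}$, $K^\perp=\mathrm{span}\{\partial/\partial y^i\}$, and $P_1,P_2$ are the complementary projectors onto $K^\perp$ and $K$. $J_1=P_1JP_1$ has components $J^i_j$; "nonsingular", inverses, determinants and cofactors of $J_1$ (resp. $\bar J_2$) refer to its restriction to $K^\perp$ (resp. $K$). Let $A(a)=\operatorname{cof}(J+aP_2)=\sum_{i=1}^{n+1}A_{(i)}a^{i-1}$, a polynomial in the constant $a$. Each 1-form $A_{(i)}\mu$ is closed, and $W_{(i)}$ is the function, determined up to a constant, with $A_{(i)}\mu=-dW_{(i)}$. The derivatives in the statement that $(g_2,\bar\mu_2,\bar J_2)$ is a cofactor system are with respect to the $x^a$ only. *)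

theory Defs
  imports "HOL-Analysis.Analysis" "HOL-Computational_Algebra.Polynomial"
begin

text \<open>
  Tensor fields on an open set of \<^typ>\<open>real^'k\<close> are given by their components in the
  standard coordinates. A type (1,1) tensor \<open>J\<close> has the components
  \<open>J\<^sup>i\<^sub>j =\<close> \<^term>\<open>J $ i $ j\<close>; a 1-form is a covector of components, on which \<open>J\<close> acts by its
  adjoint as \<^term>\<open>\<rho> v* J\<close>, i.e. \<open>(J\<rho>)\<^sub>j = J\<^sup>i\<^sub>j \<rho>\<^sub>i\<close>.
  A type (0,2) tensor, in particular a 2-form, is the matrix of its components.
\<close>

definition partial :: "'k \<Rightarrow> (real^'k \<Rightarrow> 'a::real_normed_vector) \<Rightarrow> real^'k \<Rightarrow> 'a" where
  "partial k f z = frechet_derivative f (at z) (axis k 1)"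

text \<open>The following two notions are meant for open sets \<open>U\<close>.\<close>

primrec Ck_on :: "nat \<Rightarrow> (real^'k) set \<Rightarrow> (real^'k \<Rightarrow> 'a::real_normed_vector) \<Rightarrow> bool" where
  "Ck_on 0 U f \<longleftrightarrow> continuous_on U f"
| "Ck_on (Suc r) U f \<longleftrightarrow> (\<forall>z\<in>U. f differentiable (at z)) \<and> (\<forall>k. Ck_on r U (partial k f))"

definition smooth_on :: "(real^'k) set \<Rightarrow> (real^'k \<Rightarrow> 'a::real_normed_vector) \<Rightarrow> bool" where
  "smooth_on U f \<longleftrightarrow> (\<forall>r. Ck_on r U f)"

definition differential :: "(real^'k \<Rightarrow> real) \<Rightarrow> real^'k \<Rightarrow> real^'k" where
  "differential f z = (\<chi> k. partial k f z)"

definition wedge :: "real^'k \<Rightarrow> real^'k \<Rightarrow> real^'k^'k" where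
  "wedge \<alpha> \<beta> = (\<chi> i j. \<alpha> $ i * \<beta> $ j - \<alpha> $ j * \<beta> $ i)"

definition ext_deriv :: "(real^'k \<Rightarrow> real^'k) \<Rightarrow> real^'k \<Rightarrow> real^'k^'k" where
  "ext_deriv \<rho> z = (\<chi> i j. partial i (\<lambda>w. \<rho> w $ j) z - partial j (\<lambda>w. \<rho> w $ i) z)"

definition closed_forms_exact :: "(real^'k) set \<Rightarrow> bool" where
  "closed_forms_exact U \<longleftrightarrow>
     (\<forall>\<rho>. smooth_on U \<rho> \<and> (\<forall>z\<in>U. ext_deriv \<rho> z = 0) \<longrightarrow>
       (\<exists>f. smooth_on U f \<and> (\<forall>z\<in>U. differential f z = \<rho> z)))"

text \<open>
  The derivation \<open>d\<^sub>J\<close> on functions and on 1-forms. Since it is a derivation of degree 1 and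
  anticommutes with \<open>d\<close>, for \<open>\<rho> = \<rho>\<^sub>k dx\<^sup>k\<close> one has
  \<open>d\<^sub>J \<rho> = d\<^sub>J \<rho>\<^sub>k \<and> dx\<^sup>k + \<rho>\<^sub>k d\<^sub>J (dx\<^sup>k)\<close> and \<open>d\<^sub>J (dx\<^sup>k) = - d (d\<^sub>J x\<^sup>k) = - d (J dx\<^sup>k)\<close>.
\<close>

definition dJ0 :: "(real^'k \<Rightarrow> real^'k^'k) \<Rightarrow> (real^'k \<Rightarrow> real) \<Rightarrow> real^'k \<Rightarrow> real^'k" where
  "dJ0 J f z = differential f z v* J z"

definition dJ1 :: "(real^'k \<Rightarrow> real^'k^'k) \<Rightarrow> (real^'k \<Rightarrow> real^'k) \<Rightarrow> real^'k \<Rightarrow> real^'k^'k" where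
  "dJ1 J \<rho> z = (\<Sum>k\<in>UNIV. wedge (dJ0 J (\<lambda>w. \<rho> w $ k) z) (axis k 1)
                  - \<rho> z $ k *\<^sub>R ext_deriv (\<lambda>w. axis k 1 v* J w) z)"

definition DJ1 :: "(real^'k \<Rightarrow> real^'k^'k) \<Rightarrow> (real^'k \<Rightarrow> real^'k) \<Rightarrow> real^'k \<Rightarrow> real^'k^'k" where
  "DJ1 J \<rho> z = dJ1 J \<rho> z + wedge (differential (\<lambda>w. trace (J w)) z) (\<rho> z)"

definition riemannian_metric_on :: "(real^'k) set \<Rightarrow> (real^'k \<Rightarrow> real^'k^'k) \<Rightarrow> bool" where
  "riemannian_metric_on U g \<longleftrightarrow> smooth_on U g \<and>
     (\<forall>z\<in>U. transpose (g z) = g z \<and> (\<forall>v. v \<noteq> 0 \<longrightarrow> v \<bullet> (g z *v v) > 0))"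

text \<open>The Christoffel symbol \<open>\<Gamma>\<^sup>l\<^sub>i\<^sub>j\<close> of the Levi-Civita connection.\<close>

definition christoffel :: "(real^'k \<Rightarrow> real^'k^'k) \<Rightarrow> 'k \<Rightarrow> 'k \<Rightarrow> 'k \<Rightarrow> real^'k \<Rightarrow> real" where
  "christoffel g l i j z = (\<Sum>s\<in>UNIV. matrix_inv (g z) $ l $ s *
     (partial i (\<lambda>w. g w $ s $ j) z + partial j (\<lambda>w. g w $ s $ i) z
       - partial s (\<lambda>w. g w $ i $ j) z)) / 2"

text \<open>The component \<open>T\<^sub>i\<^sub>j\<^sub>|\<^sub>k\<close> of the covariant derivative of a type (0,2) tensor field.\<close>

definition covariant_deriv ::
  "(real^'k \<Rightarrow> real^'k^'k) \<Rightarrow> (real^'k \<Rightarrow> real^'k^'k) \<Rightarrow> 'k \<Rightarrow> 'k \<Rightarrow> 'k \<Rightarrow> real^'k \<Rightarrow> real" where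
  "covariant_deriv g T i j k z = partial k (\<lambda>w. T w $ i $ j) z
     - (\<Sum>l\<in>UNIV. christoffel g l k i z * T z $ l $ j)
     - (\<Sum>l\<in>UNIV. christoffel g l k j z * T z $ i $ l)"

definition sckt_on ::
  "(real^'k) set \<Rightarrow> (real^'k \<Rightarrow> real^'k^'k) \<Rightarrow> (real^'k \<Rightarrow> real^'k^'k) \<Rightarrow> bool" where
  "sckt_on U g J \<longleftrightarrow> smooth_on U J \<and>
     (\<forall>z\<in>U. transpose (g z ** J z) = g z ** J z \<and>
       (let \<alpha> = differential (\<lambda>w. trace (J w)) z in
         \<forall>i j k. covariant_deriv g (\<lambda>w. g w ** J w) i j k z =
           (\<alpha> $ i * g z $ j $ k + \<alpha> $ j * g z $ i $ k) / 2))"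

definition cofactor_system ::
  "(real^'k) set \<Rightarrow> (real^'k \<Rightarrow> real^'k^'k) \<Rightarrow> (real^'k \<Rightarrow> real^'k) \<Rightarrow> (real^'k \<Rightarrow> real^'k^'k) \<Rightarrow> bool"
  where
  "cofactor_system U g \<mu> J \<longleftrightarrow>
     open U \<and> riemannian_metric_on U g \<and> smooth_on U \<mu> \<and> sckt_on U g J \<and>
     (\<forall>z\<in>U. invertible (J z)) \<and> (\<forall>z\<in>U. DJ1 J \<mu> z = 0)"

text \<open>
  With respect to the index type \<^typ>\<open>'m + 'n\<close>, the coordinates \<open>y\<^sup>i\<close> carry the indices
  \<^term>\<open>Inl i\<close> and the coordinates \<open>x\<^sup>a\<close> the indices \<^term>\<open>Inr a\<close>.
\<close>

definition ypart :: "'a^('m::finite + 'n::finite) \<Rightarrow> 'a^'m" where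
  "ypart z = (\<chi> i. z $ Inl i)"

definition xpart :: "'a^('m::finite + 'n::finite) \<Rightarrow> 'a^'n" where
  "xpart z = (\<chi> a. z $ Inr a)"

definition join :: "'a^'m \<Rightarrow> 'a^'n \<Rightarrow> 'a^('m::finite + 'n::finite)" where
  "join y x = (\<chi> k. case k of Inl i \<Rightarrow> y $ i | Inr a \<Rightarrow> x $ a)"

definition block11 :: "'a^('m::finite + 'n::finite)^('m + 'n) \<Rightarrow> 'a^'m^'m" where
  "block11 M = (\<chi> i j. M $ Inl i $ Inl j)"

definition block12 :: "'a^('m::finite + 'n::finite)^('m + 'n) \<Rightarrow> 'a^'n^'m" where
  "block12 M = (\<chi> i b. M $ Inl i $ Inr b)"

definition block21 :: "'a^('m::finite + 'n::finite)^('m + 'n) \<Rightarrow> 'a^'m^'n" where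
  "block21 M = (\<chi> a j. M $ Inr a $ Inl j)"

definition block22 :: "'a^('m::finite + 'n::finite)^('m + 'n) \<Rightarrow> 'a^'n^'n" where
  "block22 M = (\<chi> a b. M $ Inr a $ Inr b)"

text \<open>The projector \<open>P\<^sub>2\<close> onto the span of the \<open>\<partial>/\<partial>x\<^sup>a\<close>.\<close>

definition proj2 :: "'a::{zero,one}^('m::finite + 'n::finite)^('m + 'n)" where
  "proj2 = (\<chi> k l. case k of Inl i \<Rightarrow> 0 | Inr a \<Rightarrow> if k = l then 1 else 0)"

definition driven_cofactor_system ::
  "(real^('m::finite + 'n::finite)) set \<Rightarrow> (real^('m + 'n) \<Rightarrow> real^('m + 'n)^('m + 'n)) \<Rightarrow>
   (real^'m \<Rightarrow> real^'m^'m) \<Rightarrow> (real^'n \<Rightarrow> real^'n^'n) \<Rightarrow>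
   (real^('m + 'n) \<Rightarrow> real^('m + 'n)) \<Rightarrow>
   (real^('m + 'n) \<Rightarrow> real^('m + 'n)^('m + 'n)) \<Rightarrow> bool" where
  "driven_cofactor_system U g g1 g2 \<mu> J \<longleftrightarrow>
     closed_forms_exact U \<and> cofactor_system U g \<mu> J \<and>
     (\<forall>z\<in>U. block11 (g z) = g1 (ypart z) \<and> block22 (g z) = g2 (xpart z) \<and>
             block12 (g z) = 0 \<and> block21 (g z) = 0) \<and>
     (\<exists>Q. \<forall>z\<in>U. ypart (\<mu> z) = Q (ypart z)) \<and>
     (\<exists>V. smooth_on U V \<and> (\<forall>z\<in>U. xpart (\<mu> z) = - xpart (differential V z))) \<and>
     (\<exists>z\<in>U. \<exists>i a. partial (Inl i) (\<lambda>w. \<mu> w $ Inr a) z \<noteq> 0)"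

text \<open>
  The adjugate: the entry in row \<open>i\<close> and column \<open>j\<close> is the cofactor of \<^term>\<open>M $ j $ i\<close>,
  obtained by replacing row \<open>j\<close> of \<open>M\<close> by the \<open>i\<close>-th unit row.
\<close>

definition cof :: "'a::comm_ring_1^'k^'k \<Rightarrow> 'a^'k^'k" where
  "cof M = (\<chi> i j. det (\<chi> k. if k = j then axis i 1 else M $ k))"

text \<open>
  \<open>A\<^sub>(\<^sub>i\<^sub>)\<close>, the coefficient of \<open>a\<^bsup>i-1\<^esup>\<close> in \<open>cof (J + a P\<^sub>2)\<close>. The matrix below is \<open>J + a P\<^sub>2\<close>
  over the ring of polynomials in \<open>a\<close>.
\<close>

definition cof_coeff :: "nat \<Rightarrow> real^('m::finite + 'n::finite)^('m + 'n) \<Rightarrow> real^('m + 'n)^('m + 'n)" where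
  "cof_coeff i M = (\<chi> r s. coeff (cof (\<chi> k l. [:M $ k $ l, proj2 $ k $ l:]) $ r $ s) (i - 1))"

text \<open>\<open>J\<^sup>a\<^sub>b - J\<^sup>a\<^sub>i (J\<^sub>1\<^sup>-\<^sup>1)\<^sup>i\<^sub>j J\<^sup>j\<^sub>b\<close>\<close>

definition Jbar2 :: "real^('m::finite + 'n::finite)^('m + 'n) \<Rightarrow> real^'n^'n" where
  "Jbar2 M = block22 M - block21 M ** matrix_inv (block11 M) ** block12 M"

lemma row_expansion:
  fixes v :: "'a::comm_ring_1^'k"
  shows "(\<Sum>i\<in>UNIV. v $ i * det (\<chi> k. if k = j then axis i 1 else M $ k))
           = det (\<chi> k. if k = j then v else M $ k)"
proof -
  have v: "v = (\<Sum>i\<in>UNIV. v $ i *s axis i 1)"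
    by (simp add: vec_eq_iff axis_def if_distrib cong: if_cong)
  have "det (\<chi> k. if k = j then v else M $ k)
      = det (\<chi> k. if k = j then (\<Sum>i\<in>UNIV. v $ i *s axis i 1) else M $ k)"
    by (subst v) (rule refl)
  also have "\<dots> = (\<Sum>i\<in>UNIV. det (\<chi> k. if k = j then v $ i *s axis i 1 else M $ k))"
    by (rule det_linear_row_sum) simp
  also have "\<dots> = (\<Sum>i\<in>UNIV. v $ i * det (\<chi> k. if k = j then axis i 1 else M $ k))"
    by (simp add: det_row_mul)
  finally show ?thesis by simp
qed

lemma mult_cof: "M ** cof M = mat (det M)"
proof -
  have "(M ** cof M) $ r $ j = mat (det M) $ r $ j" for r j
  proof -
    have "(M ** cof M) $ r $ j = det (\<chi> k. if k = j then M $ r else M $ k)"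
      by (simp add: matrix_matrix_mult_def cof_def row_expansion)
    also have "\<dots> = (if r = j then det M else 0)"
    proof (cases "r = j")
      case True
      then have "(\<chi> k. if k = j then M $ r else M $ k) = M"
        by (simp add: vec_eq_iff)
      then show ?thesis using True by simp
    next
      case False
      then have "det (\<chi> k. if k = j then M $ r else M $ k) = 0"
        by (intro det_identical_rows[of r j]) (auto simp: row_def vec_eq_iff)
      then show ?thesis using False by simp
    qed
    finally show ?thesis by (simp add: mat_def)
  qed
  then show ?thesis by (simp add: vec_eq_iff)
qed

lemma cof_transpose: "cof (transpose M) = transpose (cof M)"
proof -
  have "det (\<chi> k. if k = j then axis i 1 else transpose M $ k)
      = det (\<chi> k. if k = i then axis j 1 else M $ k)" for i j
  proof -
    have eq: "(\<Prod>k\<in>UNIV. (\<chi> k. if k = i then axis j 1 else M $ k) $ k $ p k)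
        = (\<Prod>k\<in>UNIV. transpose (\<chi> k. if k = j then axis i 1 else transpose M $ k) $ k $ p k)"
      if p: "p permutes UNIV" for p :: "'b \<Rightarrow> 'b"
    proof (cases "p i = j")
      case True
      then have "p k = j \<longleftrightarrow> k = i" for k
        using p by (metis permutes_inv_eq)
      then show ?thesis
        by (intro prod.cong) (auto simp: transpose_def axis_def)
    next
      case False
      have 1: "(\<Prod>k\<in>UNIV. (\<chi> k. if k = i then axis j 1 else M $ k) $ k $ p k) = 0"
        using False by (intro prod_zero) (auto simp: axis_def intro!: exI[of _ i])
      obtain q where "p q = j"
        using p by (metis permutes_surj surjD)
      then have "(\<Prod>k\<in>UNIV. transpose (\<chi> k. if k = j then axis i 1 else transpose M $ k) $ k $ p k) = 0"
        using False
        by (intro prod_zero) (auto simp: transpose_def axis_def intro!: exI[of _ q])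
      then show ?thesis using 1 by simp
    qed
    have "det (\<chi> k. if k = i then axis j 1 else M $ k)
        = det (transpose (\<chi> k. if k = j then axis i 1 else transpose M $ k))"
      unfolding det_def by (intro sum.cong refl) (use eq in auto)
    then show ?thesis by (simp add: det_transpose)
  qed
  then show ?thesis
    unfolding cof_def by (subst (2) transpose_def) (simp add: vec_eq_iff)
qed

lemma cof_mult: "cof M ** M = mat (det M)"
proof -
  have "transpose (cof M ** M) = transpose (mat (det M))"
    using mult_cof[of "transpose M"]
    by (simp add: cof_transpose matrix_transpose_mul det_transpose transpose_mat)
  then show ?thesis by (metis transpose_transpose)
qed

lemma poly_of_int: "poly (of_int c) (a::'a::comm_ring_1) = of_int c"
  by (simp add: of_int_poly)

lemma poly_det: "poly (det M) a = det (\<chi> k l. poly (M $ k $ l) a)"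
  by (simp add: det_def poly_sum poly_prod poly_of_int)

lemma cof_poly:
  "poly (cof M $ r $ s) a = cof (\<chi> k l. poly (M $ k $ l) a) $ r $ s"
  by (auto simp: cof_def poly_det axis_def vec_eq_iff intro!: arg_cong[of _ _ det])

lemma degree_cof_le:
  fixes M :: "real^('m::finite + 'n::finite)^('m + 'n)"
  shows "degree (cof (\<chi> k l. [:M $ k $ l, proj2 $ k $ l:]) $ r $ s) \<le> CARD('n)"
proof -
  define B :: "real poly^('m + 'n)^('m + 'n)" where
    "B = (\<chi> k. if k = s then axis r 1 else (\<chi> l. [:M $ k $ l, proj2 $ k $ l:]))"
  define e :: "'m + 'n \<Rightarrow> nat" where "e k = (case k of Inl _ \<Rightarrow> 0 | Inr _ \<Rightarrow> 1)" for k
  have deg: "degree (B $ k $ l) \<le> e k" for k l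
    by (cases k) (auto simp: B_def e_def axis_def proj2_def)
  have "(\<Sum>k\<in>UNIV. e k) = CARD('n)"
    by (simp add: e_def UNIV_Plus_UNIV[symmetric] sum.Plus del: UNIV_Plus_UNIV)
  moreover have "degree (\<Prod>k\<in>UNIV. B $ k $ p k) \<le> (\<Sum>k\<in>UNIV. e k)" for p
    by (rule order_trans[OF degree_prod_sum_le]) (auto intro: sum_mono deg)
  ultimately have "degree (of_int (sign p) * (\<Prod>k\<in>UNIV. B $ k $ p k)) \<le> CARD('n)" for p
    by (metis (no_types, lifting) degree_mult_le degree_of_int add_0 order_trans)
  then have "degree (det B) \<le> CARD('n)"
    unfolding det_def by (intro degree_sum_le) (auto simp: finite_permutations)
  moreover have "cof (\<chi> k l. [:M $ k $ l, proj2 $ k $ l:]) $ r $ s = det B"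
    by (auto simp: cof_def B_def vec_eq_iff intro!: arg_cong[of _ _ det])
  ultimately show ?thesis by simp
qed

lemma cof_expansion:
  fixes M :: "real^('m::finite + 'n::finite)^('m + 'n)"
  shows "cof (M + a *\<^sub>R proj2) = (\<Sum>i = 1..CARD('n) + 1. a ^ (i - 1) *\<^sub>R cof_coeff i M)"
proof -
  have "cof (M + a *\<^sub>R proj2) $ r $ s
      = (\<Sum>i = 1..CARD('n) + 1. a ^ (i - 1) *\<^sub>R cof_coeff i M) $ r $ s" for r s
  proof -
    let ?C = "cof (\<chi> k l. [:M $ k $ l, proj2 $ k $ l:]) $ r $ s"
    have "M + a *\<^sub>R proj2 = (\<chi> k l. poly [:M $ k $ l, proj2 $ k $ l:] a)"
      by (simp add: vec_eq_iff)
    then have "cof (M + a *\<^sub>R proj2) $ r $ s = poly ?C a"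
      by (simp add: cof_poly)
    also have "\<dots> = (\<Sum>i\<le>CARD('n). coeff ?C i * a ^ i)"
      by (simp add: poly_altdef) (rule sum.mono_neutral_left,
          use degree_cof_le[of M r s] in \<open>auto simp: coeff_eq_0\<close>)
    also have "\<dots> = (\<Sum>i = 1..CARD('n) + 1. coeff ?C (i - 1) * a ^ (i - 1))"
      by (rule sum.reindex_bij_witness[of _ "\<lambda>i. i - 1" Suc]) auto
    finally show ?thesis by (simp add: cof_coeff_def mult.commute)
  qed
  then show ?thesis by (simp add: vec_eq_iff)
qed

text \<open>\<^const>\<open>dJ1\<close> is a derivation over \<^const>\<open>dJ0\<close> and anticommutes with \<open>d\<close> (where \<open>d d f = 0\<close>).\<close>

lemma partial_add:
  assumes "f differentiable (at z)" "h differentiable (at z)"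
  shows "partial k (\<lambda>w. f w + h w) z = partial k f z + partial k h z"
proof -
  have "((\<lambda>w. f w + h w) has_derivative
      (\<lambda>v. frechet_derivative f (at z) v + frechet_derivative h (at z) v)) (at z)"
    using assms by (intro has_derivative_add) (simp_all add: frechet_derivative_works)
  from frechet_derivative_at[OF this, symmetric] show ?thesis
    by (simp add: partial_def)
qed

lemma partial_mult:
  fixes f h :: "real^'k \<Rightarrow> real"
  assumes "f differentiable (at z)" "h differentiable (at z)"
  shows "partial k (\<lambda>w. f w * h w) z = partial k f z * h z + f z * partial k h z"
proof -
  have "((\<lambda>w. f w * h w) has_derivative
      (\<lambda>v. f z * frechet_derivative h (at z) v + frechet_derivative f (at z) v * h z)) (at z)"
    using assms by (intro has_derivative_mult) (simp_all add: frechet_derivative_works)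
  from frechet_derivative_at[OF this, symmetric] show ?thesis
    by (simp add: partial_def)
qed

lemma partial_sum:
  assumes "\<And>i. i \<in> S \<Longrightarrow> f i differentiable (at z)" "finite S"
  shows "partial k (\<lambda>w. \<Sum>i\<in>S. f i w) z = (\<Sum>i\<in>S. partial k (f i) z)"
proof -
  have "((\<lambda>w. \<Sum>i\<in>S. f i w) has_derivative (\<lambda>h. \<Sum>i\<in>S. frechet_derivative (f i) (at z) h)) (at z)"
    using assms(1) by (intro has_derivative_sum) (simp add: frechet_derivative_works)
  from frechet_derivative_at[OF this, symmetric] show ?thesis
    by (simp add: partial_def)
qed

lemma dJ1_nth:
  fixes J :: "real^'k \<Rightarrow> real^'k^'k"
  shows "dJ1 J \<rho> z $ i $ j =
     (\<Sum>l\<in>UNIV. J z $ l $ i * partial l (\<lambda>w. \<rho> w $ j) z)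
     - (\<Sum>l\<in>UNIV. J z $ l $ j * partial l (\<lambda>w. \<rho> w $ i) z)
     - (\<Sum>k\<in>UNIV. \<rho> z $ k * (partial i (\<lambda>w. J w $ k $ j) z - partial j (\<lambda>w. J w $ k $ i) z))"
proof -
  have row: "(axis k 1 v* M) $ l = M $ k $ l" for k l and M :: "real^'k^'k"
    by (simp add: vector_matrix_mult_def axis_def if_distrib[of "\<lambda>c. c * _"] cong: if_cong)
  have pick: "(\<Sum>k\<in>UNIV. c k * axis k 1 $ l) = c l" for c :: "'k \<Rightarrow> real" and l
    by (simp add: axis_def if_distrib[of "\<lambda>d. _ * d"] cong: if_cong)
  show ?thesis
    by (simp add: dJ1_def wedge_def ext_deriv_def row sum_subtractf pick)
      (simp add: dJ0_def differential_def vector_matrix_mult_def mult.commute)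
qed

lemma dJ1_add:
  assumes "\<And>k. (\<lambda>w. \<rho> w $ k) differentiable (at z)" "\<And>k. (\<lambda>w. \<sigma> w $ k) differentiable (at z)"
  shows "dJ1 J (\<lambda>w. \<rho> w + \<sigma> w) z = dJ1 J \<rho> z + dJ1 J \<sigma> z"
  using assms
  by (simp add: vec_eq_iff dJ1_nth partial_add sum.distrib sum_subtractf algebra_simps)

lemma dJ1_scale:
  assumes "f differentiable (at z)" "\<And>k. (\<lambda>w. \<rho> w $ k) differentiable (at z)"
  shows "dJ1 J (\<lambda>w. f w *\<^sub>R \<rho> w) z = wedge (dJ0 J f z) (\<rho> z) + f z *\<^sub>R dJ1 J \<rho> z"
  using assms
  by (simp add: vec_eq_iff dJ1_nth partial_mult sum.distrib algebra_simps wedge_def dJ0_def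
      differential_def vector_matrix_mult_def sum_distrib_left sum_distrib_right)

lemma dJ1_differential:
  assumes "\<And>k. partial k f differentiable (at z)"
    and "\<And>k l. (\<lambda>w. J w $ k $ l) differentiable (at z)"
    and "ext_deriv (differential f) z = 0"
  shows "dJ1 J (differential f) z = - ext_deriv (dJ0 J f) z"
proof -
  have sym: "partial i (partial j f) z = partial j (partial i f) z" for i j
    using assms(3) by (simp add: ext_deriv_def differential_def vec_eq_iff)
  have "partial i (\<lambda>w. dJ0 J f w $ j) z = (\<Sum>l\<in>UNIV. partial l (partial i f) z * J z $ l $ j
      + partial l f z * partial i (\<lambda>w. J w $ l $ j) z)" for i j
    using assms(1,2)
    by (simp add: dJ0_def vector_matrix_mult_def differential_def partial_sum partial_mult sym[of i])
  then show ?thesis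
    by (simp add: vec_eq_iff dJ1_nth ext_deriv_def differential_def sum.distrib
        sum_subtractf algebra_simps)
qed

end

(*
  In terms of mixed components an scKt satisfies nabla_c J = (alpha^# g_c + e_c alpha) / 2 with
  alpha = d(tr J). Take c in a direction of the x-coordinates. As g is a block sum, the block J_1
  does not depend on x, and the remaining blocks show that the Schur complement J_2bar of J_1
  satisfies the same equation with beta = alpha_2 - alpha_1 J_1^(-1) J_12 in place of alpha.
  Contracting this equation gives beta = d(tr J_2bar).

  For an scKt, D_J mu = J^T M - M^T J + (3/2) alpha wedge mu, where M = nabla mu. The matrix
  E = [[1, -J_1^(-1) J_12], [0, 1]] makes the (1,2) block of J E vanish and its (2,2) block J_2bar.
  Since mu_1 does not depend on x, the (2,1) block of M is zero, and the (2,2) block of the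
  congruence of D_J mu = 0 with E becomes the equation
  J_2bar^T M_22 - M_22^T J_2bar = - (3/2) beta wedge nu with nu = mu_2 - mu_1 J_1^(-1) J_12.
  The coefficient of a^(n-1) in cof (J + a P_2) has the last block column
  d [-J_1^(-1) J_12; 1], where d depends on J_1 only. So W_(n) has the x-differential - d nu,
  with d independent of x, and nabla nu differs from M_22 by a multiple of g_2. This multiple does
  not contribute to J_2bar^T nabla nu - (nabla nu)^T J_2bar because J_2bar is symmetric for g_2.
*)
theory Submission
  imports Defs
begin

subsection \<open>Partial derivatives and smooth maps\<close>

lemma bounded_bilinear_matrix_mult:
  "bounded_bilinear ((**) :: real^'b^'a \<Rightarrow> real^'c^'b \<Rightarrow> real^'c^'a)"
  unfolding bilinear_conv_bounded_bilinear[symmetric] bilinear_def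
  by (auto intro!: linearI simp: vec_eq_iff matrix_matrix_mult_def sum.distrib sum_distrib_left
      algebra_simps)

lemmas matrix_mult_add_left = bounded_bilinear.add_left[OF bounded_bilinear_matrix_mult]
  and matrix_mult_add_right = bounded_bilinear.add_right[OF bounded_bilinear_matrix_mult]
  and matrix_mult_diff_left = bounded_bilinear.diff_left[OF bounded_bilinear_matrix_mult]
  and matrix_mult_diff_right = bounded_bilinear.diff_right[OF bounded_bilinear_matrix_mult]
  and matrix_mult_scaleR_left = bounded_bilinear.scaleR_left[OF bounded_bilinear_matrix_mult]
  and matrix_mult_scaleR_right = bounded_bilinear.scaleR_right[OF bounded_bilinear_matrix_mult]
  and matrix_mult_zero_left = bounded_bilinear.zero_left[OF bounded_bilinear_matrix_mult]
  and matrix_mult_zero_right = bounded_bilinear.zero_right[OF bounded_bilinear_matrix_mult]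
  and matrix_mult_minus_right = bounded_bilinear.minus_right[OF bounded_bilinear_matrix_mult]

lemma differentiable_bounded_linear:
  "bounded_linear L \<Longrightarrow> f differentiable (at z) \<Longrightarrow> (\<lambda>w. L (f w)) differentiable (at z)"
  unfolding differentiable_def using bounded_linear.has_derivative by blast

lemma partial_eqI: "(f has_derivative f') (at z) \<Longrightarrow> partial k f z = f' (axis k 1)"
  by (simp add: partial_def frechet_derivative_at[symmetric])

lemma partial_bounded_linear:
  assumes "bounded_linear L" "f differentiable (at z)"
  shows "partial k (\<lambda>w. L (f w)) z = L (partial k f z)"
  using partial_eqI[OF bounded_linear.has_derivative[OF assms(1) assms(2)[unfolded frechet_derivative_works]]]
  by (simp add: partial_def)

lemma bounded_linear_nth_nth: "bounded_linear (\<lambda>M::real^'b^'a. M $ i $ j)"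
  by (rule bounded_linear_compose[OF bounded_linear_vec_nth bounded_linear_vec_nth])

lemma partial_nth:
  fixes f :: "real^'k \<Rightarrow> real^'a"
  assumes "f differentiable (at z)"
  shows "partial k (\<lambda>w. f w $ i) z = partial k f z $ i"
  by (rule partial_bounded_linear[OF bounded_linear_vec_nth assms])

lemma partial_nth_nth:
  fixes f :: "real^'k \<Rightarrow> real^'b^'a"
  assumes "f differentiable (at z)"
  shows "partial k (\<lambda>w. f w $ i $ j) z = partial k f z $ i $ j"
  by (rule partial_bounded_linear[OF bounded_linear_nth_nth assms])

lemma partial_const: "partial k (\<lambda>w. c) z = 0"
  using partial_eqI[OF has_derivative_const] .

lemma partial_bilinear:
  assumes "bounded_bilinear p" "f differentiable (at z)" "h differentiable (at z)"
  shows "partial k (\<lambda>w. p (f w) (h w)) z = p (f z) (partial k h z) + p (partial k f z) (h z)"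
  using partial_eqI[OF bounded_bilinear.FDERIV[OF assms(1) assms(2,3)[unfolded frechet_derivative_works]]]
  by (simp add: partial_def)

lemma differentiable_matrix_mult:
  fixes f :: "real^'k \<Rightarrow> real^'b^'a"
  assumes "f differentiable (at z)" "h differentiable (at z)"
  shows "(\<lambda>w. f w ** h w) differentiable (at z)"
  using bounded_bilinear.FDERIV[OF bounded_bilinear_matrix_mult assms[unfolded frechet_derivative_works]]
  by (rule differentiableI)

lemma partial_matrix_mult:
  fixes f :: "real^'k \<Rightarrow> real^'b^'a"
  assumes "f differentiable (at z)" "h differentiable (at z)"
  shows "partial k (\<lambda>w. f w ** h w) z = f z ** partial k h z + partial k f z ** h z"
  by (rule partial_bilinear[OF bounded_bilinear_matrix_mult assms])

lemma partial_diff: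
  assumes "f differentiable (at z)" "h differentiable (at z)"
  shows "partial k (\<lambda>w. f w - h w) z = partial k f z - partial k h z"
  using partial_eqI[OF has_derivative_diff[OF assms[unfolded frechet_derivative_works]]]
  by (simp add: partial_def)

lemma has_derivative_cong_open:
  assumes "open U" "z \<in> U" "\<And>w. w \<in> U \<Longrightarrow> f w = h w"
  shows "(f has_derivative D) (at z) \<longleftrightarrow> (h has_derivative D) (at z)"
  using has_derivative_transform_within_open[OF _ assms(1,2)] assms(3) by metis

text \<open>\<open>frechet_derivative\<close> chooses among the derivatives at the point, and
  functions that agree near it have the same ones; so points without a derivative are covered
  too.\<close>

lemma partial_cong_open:
  assumes "open U" "z \<in> U" "\<And>w. w \<in> U \<Longrightarrow> f w = h w"
  shows "partial k f z = partial k h z"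
  by (simp add: partial_def frechet_derivative_def has_derivative_cong_open[OF assms])

lemma differentiable_cong_open:
  assumes "open U" "z \<in> U" "\<And>w. w \<in> U \<Longrightarrow> f w = h w"
  shows "f differentiable (at z) \<longleftrightarrow> h differentiable (at z)"
  by (simp add: differentiable_def has_derivative_cong_open[OF assms])

section \<open>Closure properties of \<open>Ck_on\<close> and \<open>smooth_on\<close> on open
  sets\<close>

lemma Ck_on_cong:
  assumes "open U"
  shows "(\<And>w. w \<in> U \<Longrightarrow> f w = h w) \<Longrightarrow> Ck_on r U f \<longleftrightarrow> Ck_on r U h"
proof (induction r arbitrary: f h)
  case 0
  then show ?case by (simp cong: continuous_on_cong)
next
  case (Suc r)
  have "Ck_on r U (partial k f) \<longleftrightarrow> Ck_on r U (partial k h)" for k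
    using Suc.prems partial_cong_open[OF assms] by (intro Suc.IH) blast
  moreover have "f differentiable (at z) \<longleftrightarrow> h differentiable (at z)" if "z \<in> U" for z
    using differentiable_cong_open[OF assms that Suc.prems] .
  ultimately show ?case by simp
qed

lemma smooth_on_cong:
  assumes "open U" "\<And>w. w \<in> U \<Longrightarrow> f w = h w"
  shows "smooth_on U f \<longleftrightarrow> smooth_on U h"
  using Ck_on_cong[OF assms] by (simp add: smooth_on_def)

text \<open>Serves the inductions with a Leibniz rule, where a function itself stands next to a
  derivative and must have the lower order.\<close>

lemma Ck_on_Suc_imp: "Ck_on (Suc r) U f \<Longrightarrow> Ck_on r U f"
proof (induction r arbitrary: f)
  case 0
  then show ?case
    using differentiable_at_withinI differentiable_imp_continuous_on
    unfolding Ck_on.simps differentiable_on_def by blast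
next
  case (Suc r)
  then have "\<forall>k. Ck_on (Suc r) U (partial k f)" by simp
  then have "\<forall>k. Ck_on r U (partial k f)" using Suc.IH by blast
  moreover have "\<forall>z\<in>U. f differentiable (at z)" using Suc.prems by simp
  ultimately show ?case by simp
qed

lemma Ck_on_const:
  fixes U :: "(real^'k) set"
  shows "Ck_on r U (\<lambda>w. c)"
proof (induction r arbitrary: c)
  case (Suc r)
  have "partial k (\<lambda>w :: real^'k. c) = (\<lambda>w. 0)" for k by (simp add: fun_eq_iff partial_const)
  with Suc show ?case by simp
qed simp

lemma Ck_on_bounded_linear:
  assumes "open U" "bounded_linear L"
  shows "Ck_on r U f \<Longrightarrow> Ck_on r U (\<lambda>w. L (f w))"
proof (induction r arbitrary: f)
  case 0
  then show ?case using bounded_linear.continuous_on[OF assms(2)] by simp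
next
  case (Suc r)
  have "Ck_on r U (partial k (\<lambda>w. L (f w)))" for k
    using Suc.IH[of "partial k f"] Suc.prems
    by (subst Ck_on_cong[OF assms(1), of _ "\<lambda>w. L (partial k f w)"])
      (auto simp: partial_bounded_linear[OF assms(2)])
  then show ?case
    using Suc.prems by (auto intro: differentiable_bounded_linear[OF assms(2)])
qed

lemma Ck_on_vec:
  fixes f :: "real^'k \<Rightarrow> 'a::euclidean_space^'i"
  assumes "open U"
  shows "(\<And>i. Ck_on r U (\<lambda>w. f w $ i)) \<Longrightarrow> Ck_on r U f"
proof (induction r arbitrary: f)
  case 0
  then have "continuous_on U (\<lambda>w. \<chi> i. f w $ i)" by (intro continuous_on_vec_lambda) simp
  then show ?case by simp
next
  case (Suc r)
  have d: "f differentiable (at z)" if "z \<in> U" for z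
    unfolding differentiable_componentwise_within[of f]
  proof
    fix b :: "'a^'i" assume "b \<in> Basis"
    then obtain i u where b: "b = axis i u" by (auto simp: Basis_vec_def)
    have "(\<lambda>w. f w $ i) differentiable (at z)" using Suc.prems[of i] that by simp
    from differentiable_bounded_linear[OF bounded_linear_inner_left[of u] this]
    show "(\<lambda>w. f w \<bullet> b) differentiable (at z)" by (simp add: b inner_axis)
  qed
  have "Ck_on r U (partial k f)" for k
  proof (rule Suc.IH)
    fix i
    have "Ck_on r U (partial k (\<lambda>w. f w $ i))" using Suc.prems[of i] by simp
    then show "Ck_on r U (\<lambda>w. partial k f w $ i)"
      by (subst Ck_on_cong[OF assms, of _ "partial k (\<lambda>w. f w $ i)"])
       (simp_all add: partial_bounded_linear[OF bounded_linear_vec_nth d])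
  qed
  then show ?case using d by simp
qed

lemma Ck_on_add:
  assumes "open U"
  shows "Ck_on r U f \<Longrightarrow> Ck_on r U h \<Longrightarrow> Ck_on r U (\<lambda>w. f w + h w)"
proof (induction r arbitrary: f h)
  case 0
  then show ?case by (simp add: continuous_on_add)
next
  case (Suc r)
  have "Ck_on r U (partial k (\<lambda>w. f w + h w))" for k
    using Suc.IH[of "partial k f" "partial k h"] Suc.prems
    by (subst Ck_on_cong[OF assms, of _ "\<lambda>w. partial k f w + partial k h w"])
      (auto simp: partial_add)
  then show ?case using Suc.prems by simp
qed

lemma Ck_on_mult:
  fixes f h :: "real^'k \<Rightarrow> real"
  assumes "open U"
  shows "Ck_on r U f \<Longrightarrow> Ck_on r U h \<Longrightarrow> Ck_on r U (\<lambda>w. f w * h w)"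
proof (induction r arbitrary: f h)
  case 0
  then show ?case by (simp add: continuous_on_mult)
next
  case (Suc r)
  have "Ck_on r U (\<lambda>w. partial k f w * h w + f w * partial k h w)" for k
    using Suc.prems Suc.prems[THEN Ck_on_Suc_imp] by (intro Ck_on_add[OF assms] Suc.IH) auto
  then have "Ck_on r U (partial k (\<lambda>w. f w * h w))" for k
    using Suc.prems
    by (subst Ck_on_cong[OF assms, of _ "\<lambda>w. partial k f w * h w + f w * partial k h w"])
      (auto simp: partial_mult)
  then show ?case using Suc.prems by simp
qed

lemma Ck_on_inverse:
  fixes f :: "real^'k \<Rightarrow> real"
  assumes "open U" "\<And>w. w \<in> U \<Longrightarrow> f w \<noteq> 0"
  shows "Ck_on r U f \<Longrightarrow> Ck_on r U (\<lambda>w. inverse (f w))"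
proof (induction r)
  case 0
  then show ?case using assms by (auto intro!: continuous_on_inverse)
next
  case (Suc r)
  have d: "((\<lambda>w. inverse (f w)) has_derivative
      (\<lambda>v. - (inverse (f z) * frechet_derivative f (at z) v * inverse (f z)))) (at z)"
    if "z \<in> U" for z
    using Suc.prems that assms(2)
    by (intro Deriv.has_derivative_inverse) (simp_all flip: frechet_derivative_works)
  have i: "Ck_on r U (\<lambda>w. inverse (f w))" using Suc Ck_on_Suc_imp by blast
  have "Ck_on r U (\<lambda>w. (- 1) * (inverse (f w) * partial k f w * inverse (f w)))" for k
    using Suc.prems i by (intro Ck_on_mult[OF assms(1)] Ck_on_const) auto
  then have "Ck_on r U (partial k (\<lambda>w. inverse (f w)))" for k
    by (subst Ck_on_cong[OF assms(1), of _
          "\<lambda>w. (- 1) * (inverse (f w) * partial k f w * inverse (f w))"])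
      (use partial_eqI[OF d] in \<open>auto simp: partial_def\<close>)
  then show ?case using d by (auto simp: differentiable_def)
qed

lemma Ck_on_sum:
  assumes "open U" "finite S" "\<And>i. i \<in> S \<Longrightarrow> Ck_on r U (f i)"
  shows "Ck_on r U (\<lambda>w. \<Sum>i\<in>S. f i w)"
  using assms(2,3) by (induction S) (auto intro: Ck_on_const Ck_on_add[OF assms(1)])

lemma Ck_on_prod:
  fixes f :: "'i \<Rightarrow> real^'k \<Rightarrow> real"
  assumes "open U" "finite S" "\<And>i. i \<in> S \<Longrightarrow> Ck_on r U (f i)"
  shows "Ck_on r U (\<lambda>w. \<Prod>i\<in>S. f i w)"
  using assms(2,3) by (induction S) (auto intro: Ck_on_const Ck_on_mult[OF assms(1)])

lemma smooth_on_imp_differentiable: "smooth_on U f \<Longrightarrow> z \<in> U \<Longrightarrow> f differentiable (at z)"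
  unfolding smooth_on_def by (meson Ck_on.simps(2))

lemma smooth_on_partial: "smooth_on U f \<Longrightarrow> smooth_on U (partial k f)"
  unfolding smooth_on_def by (meson Ck_on.simps(2))

lemma smooth_on_bounded_linear:
  "open U \<Longrightarrow> bounded_linear L \<Longrightarrow> smooth_on U f \<Longrightarrow> smooth_on U (\<lambda>w. L (f w))"
  by (simp add: smooth_on_def Ck_on_bounded_linear)

lemma smooth_on_nth_nth:
  fixes f :: "real^'k \<Rightarrow> real^'b^'a"
  shows "open U \<Longrightarrow> smooth_on U f \<Longrightarrow> smooth_on U (\<lambda>w. f w $ i $ j)"
  by (rule smooth_on_bounded_linear[OF _ bounded_linear_nth_nth])

lemma smooth_on_vec:
  fixes f :: "real^'k \<Rightarrow> 'a::euclidean_space^'i"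
  shows "open U \<Longrightarrow> (\<And>i. smooth_on U (\<lambda>w. f w $ i)) \<Longrightarrow> smooth_on U f"
  by (simp add: smooth_on_def Ck_on_vec)

lemma smooth_on_const: "smooth_on U (\<lambda>w. c)"
  by (simp add: smooth_on_def Ck_on_const)

lemma smooth_on_add: "open U \<Longrightarrow> smooth_on U f \<Longrightarrow> smooth_on U h \<Longrightarrow> smooth_on U (\<lambda>w. f w + h w)"
  by (simp add: smooth_on_def Ck_on_add)

lemma smooth_on_mult:
  fixes f h :: "real^'k \<Rightarrow> real"
  shows "open U \<Longrightarrow> smooth_on U f \<Longrightarrow> smooth_on U h \<Longrightarrow> smooth_on U (\<lambda>w. f w * h w)"
  by (simp add: smooth_on_def Ck_on_mult)

lemma smooth_on_inverse:
  fixes f :: "real^'k \<Rightarrow> real"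
  shows "open U \<Longrightarrow> (\<And>w. w \<in> U \<Longrightarrow> f w \<noteq> 0) \<Longrightarrow> smooth_on U f \<Longrightarrow> smooth_on U (\<lambda>w. inverse (f w))"
  by (simp add: smooth_on_def Ck_on_inverse)

lemma smooth_on_sum:
  "open U \<Longrightarrow> finite S \<Longrightarrow> (\<And>i. i \<in> S \<Longrightarrow> smooth_on U (f i)) \<Longrightarrow> smooth_on U (\<lambda>w. \<Sum>i\<in>S. f i w)"
  by (simp add: smooth_on_def Ck_on_sum)

lemma smooth_on_matrix_mult:
  fixes f :: "real^'k \<Rightarrow> real^'b^'a" and h :: "real^'k \<Rightarrow> real^'c^'b"
  assumes "open U" "smooth_on U f" "smooth_on U h"
  shows "smooth_on U (\<lambda>w. f w ** h w)"
  by (intro smooth_on_vec[OF assms(1)])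
    (auto simp: matrix_matrix_mult_def
      intro!: smooth_on_sum smooth_on_mult smooth_on_nth_nth assms)

text \<open>Smoothness is asked entry by entry to suit the matrices with one replaced row that occur
  in \<open>cof\<close>.\<close>

lemma smooth_on_det:
  fixes f :: "real^'k \<Rightarrow> real^'a^'a"
  assumes "open U" "\<And>i j. smooth_on U (\<lambda>w. f w $ i $ j)"
  shows "smooth_on U (\<lambda>w. det (f w))"
  using assms unfolding det_def smooth_on_def
  by (auto intro!: Ck_on_sum Ck_on_mult Ck_on_prod Ck_on_const simp: finite_permutations)

section \<open>Inverse matrices and their smooth dependence on a parameter\<close>

lemma
  fixes M :: "real^'a^'a"
  assumes "invertible M"
  shows matrix_inv_right: "M ** matrix_inv M = mat 1" and matrix_inv_left: "matrix_inv M ** M = mat 1"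
  using assms someI_ex[of "\<lambda>N. M ** N = mat 1 \<and> N ** M = mat 1"]
  by (auto simp: invertible_def matrix_inv_def)

lemma matrix_inv_eqI:
  fixes M :: "real^'a^'a"
  assumes "M ** N = mat 1"
  shows "matrix_inv M = N"
proof -
  have "invertible M" using assms by (auto simp: invertible_right_inverse)
  then have "matrix_inv M ** (M ** N) = N"
    by (simp add: matrix_mul_assoc matrix_inv_left)
  then show ?thesis by (simp add: assms)
qed

lemma matrix_inv_cof:
  fixes M :: "real^'a^'a"
  assumes "invertible M"
  shows "matrix_inv M = inverse (det M) *\<^sub>R cof M"
  using assms
  by (intro matrix_inv_eqI)
    (auto simp: matrix_mult_scaleR_right mult_cof vec_eq_iff mat_def invertible_det_nz)

text \<open>Cramer's rule: the entries of the inverse are cofactors divided by the determinant,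
  which does not vanish on \<open>U\<close>.\<close>

lemma smooth_on_matrix_inv:
  fixes f :: "real^'k \<Rightarrow> real^'a^'a"
  assumes "open U" "smooth_on U f" "\<And>z. z \<in> U \<Longrightarrow> invertible (f z)"
  shows "smooth_on U (\<lambda>z. matrix_inv (f z))"
proof -
  have "smooth_on U (\<lambda>z. (if k = j then axis i 1 else f z $ k) $ l)" for i j k l
    using assms by (cases "k = j") (simp_all add: smooth_on_const smooth_on_nth_nth)
  then have "smooth_on U (\<lambda>z. cof (f z) $ i $ j)" for i j
    by (simp add: cof_def smooth_on_det[OF assms(1)])
  moreover have "smooth_on U (\<lambda>z. inverse (det (f z)))"
    using assms
    by (intro smooth_on_inverse smooth_on_det smooth_on_nth_nth) (auto simp: invertible_det_nz)
  ultimately have "smooth_on U (\<lambda>z. inverse (det (f z)) *\<^sub>R cof (f z))"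
    by (intro smooth_on_vec[OF assms(1)]) (simp add: smooth_on_mult[OF assms(1)])
  then show ?thesis
    by (subst smooth_on_cong[OF assms(1), of _ "\<lambda>z. inverse (det (f z)) *\<^sub>R cof (f z)"])
      (auto simp: matrix_inv_cof assms(3))
qed

section \<open>Derivatives along coordinate lines\<close>

lemma partial_along:
  assumes "f differentiable (at z)"
  shows "((\<lambda>t. f (z + t *\<^sub>R axis k 1)) has_derivative (\<lambda>t. t *\<^sub>R partial k f z)) (at 0)"
proof -
  have "((\<lambda>t::real. z + t *\<^sub>R axis k 1) has_derivative (\<lambda>t. t *\<^sub>R axis k 1)) (at 0)"
    by (auto intro!: derivative_eq_intros)
  then have "(f \<circ> (\<lambda>t::real. z + t *\<^sub>R axis k 1) has_derivative
      frechet_derivative f (at z) \<circ> (\<lambda>t. t *\<^sub>R axis k 1)) (at 0)"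
    using assms by (intro diff_chain_at) (simp_all add: frechet_derivative_works)
  moreover have "frechet_derivative f (at z) (t *\<^sub>R axis k 1) = t *\<^sub>R partial k f z" for t
    unfolding partial_def
    by (rule linear_cmul) (use assms in \<open>simp add: linear_frechet_derivative\<close>)
  ultimately show ?thesis by (simp add: o_def)
qed

text \<open>A partial derivative sees only the restriction to one coordinate line. This turns
  independence of some coordinates, as for the blocks of the metric, into vanishing derivatives; the
  two functions may live on different spaces.\<close>

lemma partial_cong_along:
  assumes "f differentiable (at z)" "h differentiable (at x)"
    and "\<forall>\<^sub>F t in nhds 0. f (z + t *\<^sub>R axis k 1) = h (x + t *\<^sub>R axis l 1)"
  shows "partial k f z = partial l h x"
proof -
  from assms(3) obtain T where T: "open T" "0 \<in> T"
    "\<And>t. t \<in> T \<Longrightarrow> f (z + t *\<^sub>R axis k 1) = h (x + t *\<^sub>R axis l 1)"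
    unfolding eventually_nhds by blast
  have "((\<lambda>t. f (z + t *\<^sub>R axis k 1)) has_derivative (\<lambda>t. t *\<^sub>R partial l h x)) (at 0)"
    using partial_along[OF assms(2), of l] has_derivative_cong_open[OF T(1,2), OF T(3)] by simp
  from has_derivative_unique[OF partial_along[OF assms(1)] this]
  show ?thesis by (metis scaleR_one)
qed

lemma eventually_line_mem:
  fixes z :: "real^'k"
  assumes "open U" "z \<in> U"
  shows "\<forall>\<^sub>F t in nhds 0. z + t *\<^sub>R axis k 1 \<in> U"
proof -
  have "open ((\<lambda>t. z + t *\<^sub>R axis k 1) -` U)"
    by (intro open_vimage assms continuous_intros)
  then show ?thesis using assms(2) by (force simp: eventually_nhds)
qed

subsection \<open>Special conformal Killing tensors in mixed components\<close>

lemma riemannian_metric_invertible: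
  assumes "riemannian_metric_on U g" "z \<in> U"
  shows "invertible (g z)"
proof -
  have "v = 0" if "g z *v v = 0" for v
    using assms that by (force simp: riemannian_metric_on_def)
  then show ?thesis by (simp add: invertible_left_inverse matrix_left_invertible_ker)
qed

lemma riemannian_metric_sym:
  assumes "riemannian_metric_on U g" "z \<in> U"
  shows "g z $ i $ j = g z $ j $ i"
proof -
  have "g z $ i $ j = transpose (g z) $ i $ j" using assms by (simp add: riemannian_metric_on_def)
  then show ?thesis by (simp add: transpose_def)
qed

lemma partial_metric_sym:
  assumes "open U" "riemannian_metric_on U g" "z \<in> U"
  shows "partial k (\<lambda>w. g w $ i $ j) z = partial k (\<lambda>w. g w $ j $ i) z"
  by (rule partial_cong_open[OF assms(1,3)]) (rule riemannian_metric_sym[OF assms(2)])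

text \<open>The connection form in the coordinate direction \<open>c\<close>, as a matrix with the
  upper index as row. It turns covariant derivatives into matrix identities that can be split into
  blocks.\<close>

definition conn :: "(real^'k \<Rightarrow> real^'k^'k) \<Rightarrow> 'k \<Rightarrow> real^'k \<Rightarrow> real^'k^'k" where
  "conn g c z = (\<chi> l i. christoffel g l c i z)"

lemma christoffel_sym:
  assumes "open U" "riemannian_metric_on U g" "z \<in> U"
  shows "christoffel g l i j z = christoffel g l j i z"
  by (simp add: christoffel_def partial_metric_sym[OF assms] algebra_simps)

text \<open>Lowering the upper index gives the Christoffel symbols of the first kind, which no
  longer contain the inverse metric.\<close>

lemma metric_mult_conn:
  assumes "riemannian_metric_on U g" "z \<in> U"
  shows "g z ** conn g c z = (\<chi> s i. (partial c (\<lambda>w. g w $ s $ i) z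
    + partial i (\<lambda>w. g w $ s $ c) z - partial s (\<lambda>w. g w $ c $ i) z) / 2)" (is "_ = ?L")
proof -
  have "conn g c z = matrix_inv (g z) ** ?L"
    by (simp add: conn_def christoffel_def matrix_matrix_mult_def sum_divide_distrib)
  then have "g z ** conn g c z = (g z ** matrix_inv (g z)) ** ?L"
    by (simp add: matrix_mul_assoc)
  then show ?thesis
    using riemannian_metric_invertible[OF assms] by (simp add: matrix_inv_right)
qed

text \<open>Metric compatibility: in the sum of a first-kind symbol and its transpose the last two
  terms cancel.\<close>

lemma partial_metric:
  assumes "open U" "riemannian_metric_on U g" "z \<in> U"
  shows "partial c g z = transpose (conn g c z) ** g z + g z ** conn g c z"
proof -
  have g: "g differentiable (at z)" and sym: "transpose (g z) = g z"
    using assms by (auto simp: riemannian_metric_on_def smooth_on_imp_differentiable)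
  have "transpose (conn g c z) ** g z = transpose (g z ** conn g c z)"
    by (simp add: matrix_transpose_mul sym)
  then show ?thesis
    by (simp add: metric_mult_conn[OF assms(2,3)] vec_eq_iff transpose_def partial_nth_nth[OF g, symmetric]
        partial_metric_sym[OF assms] field_simps)
qed

lemma covariant_deriv_conn:
  assumes "T differentiable (at z)"
  shows "(\<chi> i j. covariant_deriv g T i j c z)
    = partial c T z - transpose (conn g c z) ** T z - T z ** conn g c z"
  by (simp add: vec_eq_iff covariant_deriv_def conn_def matrix_matrix_mult_def transpose_def
      partial_nth_nth[OF assms] mult.commute)

text \<open>The components \<open>J\<^sup>i\<^sub>j\<^sub>|\<^sub>c\<close>.\<close>

definition endo_deriv ::
  "(real^'k \<Rightarrow> real^'k^'k) \<Rightarrow> (real^'k \<Rightarrow> real^'k^'k) \<Rightarrow> 'k \<Rightarrow> real^'k \<Rightarrow> real^'k^'k" where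
  "endo_deriv g J c z = partial c J z + conn g c z ** J z - J z ** conn g c z"

text \<open>With \<open>b = column c (g z)\<close> this is the right-hand side of the scKt equation
  for the derivative index \<open>c\<close>.\<close>

definition sym_prod :: "real^'k \<Rightarrow> real^'k \<Rightarrow> real^'k^'k" where
  "sym_prod a b = (\<chi> i j. (a $ i * b $ j + a $ j * b $ i) / 2)"

text \<open>The metric is parallel, so lowering an index commutes with covariant
  differentiation.\<close>

lemma covariant_deriv_lower:
  assumes "open U" "riemannian_metric_on U g" "z \<in> U" "J differentiable (at z)"
  shows "(\<chi> i j. covariant_deriv g (\<lambda>w. g w ** J w) i j c z) = g z ** endo_deriv g J c z"
proof -
  have g: "g differentiable (at z)"
    using assms by (auto simp: riemannian_metric_on_def smooth_on_imp_differentiable)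
  show ?thesis
    by (simp add: covariant_deriv_conn differentiable_matrix_mult partial_matrix_mult g assms(4)
        partial_metric[OF assms(1-3)] endo_deriv_def matrix_mult_add_left matrix_mult_add_right
        matrix_mult_diff_right matrix_mul_assoc)
qed

text \<open>Collects the scKt equation into one matrix equation per direction, the form in which
  blocks can be taken.\<close>

lemma sckt_on_iff:
  assumes "open U" "riemannian_metric_on U g"
  shows "sckt_on U g J \<longleftrightarrow> smooth_on U J \<and> (\<forall>z\<in>U. transpose (g z ** J z) = g z ** J z \<and>
    (\<forall>c. g z ** endo_deriv g J c z
      = sym_prod (differential (\<lambda>w. trace (J w)) z) (column c (g z))))"
proof -
  have "(\<forall>i j k. covariant_deriv g (\<lambda>w. g w ** J w) i j k z
      = (\<alpha> $ i * g z $ j $ k + \<alpha> $ j * g z $ i $ k) / 2)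
      \<longleftrightarrow> (\<forall>c. g z ** endo_deriv g J c z = sym_prod \<alpha> (column c (g z)))"
    if "smooth_on U J" "z \<in> U" for z \<alpha>
    unfolding covariant_deriv_lower[OF assms that(2) smooth_on_imp_differentiable[OF that], symmetric]
    by (auto simp: vec_eq_iff sym_prod_def column_def)
  then show ?thesis unfolding sckt_on_def Let_def by blast
qed

text \<open>Raising the first index: the inverse metric acts on \<open>a\<close> in one term and
  cancels against column \<open>c\<close> of the metric in the other.\<close>

lemma metric_mult_eq_sym_prod:
  assumes "riemannian_metric_on U g" "z \<in> U" "g z ** N = sym_prod a (column c (g z))"
  shows "N $ k $ j = ((matrix_inv (g z) *v a) $ k * g z $ j $ c + (if k = c then a $ j else 0)) / 2"
proof -
  let ?G = "matrix_inv (g z)"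
  have inv: "?G ** g z = mat 1"
    using riemannian_metric_invertible[OF assms(1,2)] by (rule matrix_inv_left)
  have d: "(\<Sum>i\<in>UNIV. ?G $ k $ i * g z $ i $ c) = (if k = c then 1 else 0)"
    using arg_cong[OF inv, of "\<lambda>M. M $ k $ c"] by (simp add: matrix_matrix_mult_def mat_def)
  have "N = ?G ** (g z ** N)" by (simp add: matrix_mul_assoc inv)
  then have "N $ k $ j = (?G ** sym_prod a (column c (g z))) $ k $ j" by (simp add: assms(3))
  also have "\<dots> = ((?G *v a) $ k * g z $ j $ c + a $ j * (\<Sum>i\<in>UNIV. ?G $ k $ i * g z $ i $ c)) / 2"
    by (simp add: matrix_matrix_mult_def matrix_vector_mult_def sym_prod_def column_def
        sum_divide_distrib sum_distrib_left sum_distrib_right sum.distrib[symmetric] field_simps)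
  finally show ?thesis using d by simp
qed

text \<open>After raising the index, each of the two terms contributes half of \<open>a $ c\<close>
  to the trace.\<close>

lemma trace_metric_mult_eq_sym_prod:
  assumes "riemannian_metric_on U g" "z \<in> U" "g z ** N = sym_prod a (column c (g z))"
  shows "trace N = a $ c"
proof -
  let ?G = "matrix_inv (g z)"
  have "g z *v (?G *v a) = a"
    using riemannian_metric_invertible[OF assms(1,2)]
    by (simp add: matrix_vector_mul_assoc matrix_inv_right)
  then have "(g z *v (?G *v a)) $ c = a $ c" by simp
  moreover have "(g z *v (?G *v a)) $ c = (\<Sum>k\<in>UNIV. (?G *v a) $ k * g z $ k $ c)"
    by (subst matrix_vector_mult_def)
      (auto simp: riemannian_metric_sym[OF assms(1,2)] mult.commute intro!: sum.cong)
  ultimately have "(\<Sum>k\<in>UNIV. (?G *v a) $ k * g z $ k $ c) = a $ c" by simp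
  then show ?thesis
    by (simp add: trace_def metric_mult_eq_sym_prod[OF assms] sum_divide_distrib[symmetric] sum.distrib)
qed

text \<open>The connection enters through a commutator, which has trace zero.\<close>

lemma trace_endo_deriv:
  fixes J :: "real^'k \<Rightarrow> real^'k^'k"
  assumes "J differentiable (at z)"
  shows "trace (endo_deriv g J c z) = partial c (\<lambda>w. trace (J w)) z"
proof -
  have "bounded_linear (trace :: real^'k^'k \<Rightarrow> real)"
    unfolding trace_def by (intro bounded_linear_sum bounded_linear_nth_nth)
  from partial_bounded_linear[OF this assms] show ?thesis
    by (simp add: endo_deriv_def trace_add trace_sub trace_mul_sym[of "conn g c z"])
qed

text \<open>Contraction forces the covector in an scKt equation to be the differential of the trace,
  so the equation may be verified first with a covector found in another way.\<close>

lemma endo_deriv_eq_sym_prod_imp: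
  assumes "riemannian_metric_on U g" "z \<in> U" "J differentiable (at z)"
    and "\<And>c. g z ** endo_deriv g J c z = sym_prod a (column c (g z))"
  shows "a = differential (\<lambda>w. trace (J w)) z"
  using trace_metric_mult_eq_sym_prod[OF assms(1,2,4)]
  by (simp add: vec_eq_iff differential_def trace_endo_deriv[OF assms(3)])

section \<open>The operator \<open>D_J\<close> in covariant form\<close>

text \<open>The first index is that of the differentiation: the \<open>(l, j)\<close> entry is \<open>\<rho>\<^sub>j\<^sub>|\<^sub>l\<close>.\<close>

definition form_deriv ::
  "(real^'k \<Rightarrow> real^'k^'k) \<Rightarrow> (real^'k \<Rightarrow> real^'k) \<Rightarrow> real^'k \<Rightarrow> real^'k^'k" where
  "form_deriv g \<rho> z = (\<chi> l. partial l \<rho> z - \<rho> z v* conn g l z)"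

text \<open>The scKt equation determines the curl of \<open>J\<close>. Its Kronecker terms give half
  of the wedge product, to which \<open>DJ1\<close> adds a whole one; its Christoffel terms complete
  the derivatives of \<rho> to covariant ones.\<close>

lemma DJ1_eq:
  assumes "open U" "riemannian_metric_on U g" "sckt_on U g J" "z \<in> U" "\<rho> differentiable (at z)"
  shows "DJ1 J \<rho> z = transpose (J z) ** form_deriv g \<rho> z - transpose (form_deriv g \<rho> z) ** J z
    + (3/2) *\<^sub>R wedge (differential (\<lambda>w. trace (J w)) z) (\<rho> z)"
proof -
  define \<alpha> where "\<alpha> = differential (\<lambda>w. trace (J w)) z"
  define \<Gamma> where "\<Gamma> k l j = christoffel g k l j z" for k l j
  define s where "s = matrix_inv (g z) *v \<alpha>"
  have J: "J differentiable (at z)"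
    using assms by (auto simp: sckt_on_def smooth_on_imp_differentiable)
  have \<Gamma>: "\<Gamma> k l j = \<Gamma> k j l" for k l j
    unfolding \<Gamma>_def by (rule christoffel_sym[OF assms(1,2,4)])
  have N: "endo_deriv g J c z $ k $ j = (s $ k * g z $ j $ c + (if k = c then \<alpha> $ j else 0)) / 2"
    for c k j
    unfolding s_def
    by (rule metric_mult_eq_sym_prod[OF assms(2,4)])
      (use assms in \<open>simp add: sckt_on_iff[OF assms(1,2)] \<alpha>_def\<close>)
  \<comment> \<open>The mixed scKt equation solved for the ordinary derivative of
    \<open>J\<close>.\<close>
  have dJ: "partial i (\<lambda>w. J w $ k $ j) z = (s $ k * g z $ j $ i + (if k = i then \<alpha> $ j else 0)) / 2
      - (\<Sum>l\<in>UNIV. \<Gamma> k i l * J z $ l $ j) + (\<Sum>l\<in>UNIV. J z $ k $ l * \<Gamma> l i j)" for i j k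
  proof -
    have "endo_deriv g J i z $ k $ j = partial i (\<lambda>w. J w $ k $ j) z
      + (\<Sum>l\<in>UNIV. \<Gamma> k i l * J z $ l $ j) - (\<Sum>l\<in>UNIV. J z $ k $ l * \<Gamma> l i j)"
      by (simp add: partial_nth_nth[OF J] endo_deriv_def conn_def matrix_matrix_mult_def \<Gamma>_def)
    then show ?thesis unfolding N by linarith
  qed
  \<comment> \<open>Antisymmetrizing in \<open>i\<close> and \<open>j\<close> removes the
    \<open>s\<close> terms by symmetry of the metric and the terms with \<open>J\<close> on the left
    by absence of torsion.\<close>
  have curl: "partial i (\<lambda>w. J w $ k $ j) z - partial j (\<lambda>w. J w $ k $ i) z
      = ((if k = i then \<alpha> $ j else 0) - (if k = j then \<alpha> $ i else 0)) / 2
      - (\<Sum>l\<in>UNIV. \<Gamma> k i l * J z $ l $ j) + (\<Sum>l\<in>UNIV. \<Gamma> k j l * J z $ l $ i)" for i j k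
    by (simp add: dJ \<Gamma>[of _ i j] riemannian_metric_sym[OF assms(2,4)] field_simps)
  have pick: "(\<Sum>k\<in>UNIV. \<rho> z $ k * (if k = i then c else 0)) = \<rho> z $ i * c" for i c
    by (simp add: if_distrib cong: if_cong)
  have A: "(\<Sum>k\<in>UNIV. \<rho> z $ k * (partial i (\<lambda>w. J w $ k $ j) z - partial j (\<lambda>w. J w $ k $ i) z))
     = (\<rho> z $ i * \<alpha> $ j - \<rho> z $ j * \<alpha> $ i) / 2
      - (\<Sum>k\<in>UNIV. \<rho> z $ k * (\<Sum>l\<in>UNIV. \<Gamma> k i l * J z $ l $ j))
      + (\<Sum>k\<in>UNIV. \<rho> z $ k * (\<Sum>l\<in>UNIV. \<Gamma> k j l * J z $ l $ i))" for i j
    by (simp add: curl ring_distribs sum.distrib sum_subtractf pick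
        sum_divide_distrib[symmetric] diff_divide_distrib)
  \<comment> \<open>The double sums left over from the curl are the connection terms of
    \<open>form_deriv\<close>, up to the order of summation.\<close>
  have B: "(\<Sum>k\<in>UNIV. \<rho> z $ k * (\<Sum>l\<in>UNIV. \<Gamma> k i l * J z $ l $ j))
      = (\<Sum>l\<in>UNIV. J z $ l $ j * (\<Sum>k\<in>UNIV. \<rho> z $ k * \<Gamma> k l i))" for i j
    unfolding sum_distrib_left
    by (subst sum.swap) (simp add: \<Gamma>[of _ i] mult_ac)
  have C: "(transpose (J z) ** form_deriv g \<rho> z) $ i $ j
      = (\<Sum>l\<in>UNIV. J z $ l $ i * partial l (\<lambda>w. \<rho> w $ j) z)
      - (\<Sum>l\<in>UNIV. J z $ l $ i * (\<Sum>k\<in>UNIV. \<rho> z $ k * \<Gamma> k l j))" for i j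
    by (simp add: matrix_matrix_mult_def transpose_def form_deriv_def vector_matrix_mult_def
        conn_def \<Gamma>_def partial_nth[OF assms(5)] right_diff_distrib sum_subtractf)
  have T: "(transpose (form_deriv g \<rho> z) ** J z) $ i $ j
      = (transpose (J z) ** form_deriv g \<rho> z) $ j $ i" for i j
    by (simp add: matrix_matrix_mult_def transpose_def mult.commute)
  have "DJ1 J \<rho> z $ i $ j = (transpose (J z) ** form_deriv g \<rho> z
      - transpose (form_deriv g \<rho> z) ** J z + (3/2) *\<^sub>R wedge \<alpha> (\<rho> z)) $ i $ j" for i j
  proof -
    have "DJ1 J \<rho> z $ i $ j = (\<Sum>l\<in>UNIV. J z $ l $ i * partial l (\<lambda>w. \<rho> w $ j) z)
      - (\<Sum>l\<in>UNIV. J z $ l $ j * partial l (\<lambda>w. \<rho> w $ i) z)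
      - (\<Sum>k\<in>UNIV. \<rho> z $ k * (partial i (\<lambda>w. J w $ k $ j) z - partial j (\<lambda>w. J w $ k $ i) z))
      + (\<alpha> $ i * \<rho> z $ j - \<alpha> $ j * \<rho> z $ i)"
      by (simp only: DJ1_def \<alpha>_def vector_add_component dJ1_nth) (simp add: wedge_def)
    then show ?thesis
      by (simp only: A B C T vector_add_component vector_minus_component vector_scaleR_component)
        (simp add: wedge_def field_simps)
  qed
  then show ?thesis unfolding \<alpha>_def by (simp add: vec_eq_iff)
qed

subsection \<open>Block matrices and the pencil \<open>J + a P\<^sub>2\<close>\<close>

lemma sum_UNIV_Plus:
  "(\<Sum>k\<in>UNIV. f k) = (\<Sum>i\<in>UNIV. f (Inl i)) + (\<Sum>a\<in>UNIV. f (Inr a))"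
  for f :: "'m::finite + 'n::finite \<Rightarrow> 'a::comm_monoid_add"
  by (simp add: UNIV_Plus_UNIV[symmetric] sum.Plus del: UNIV_Plus_UNIV)

lemmas block_defs = block11_def block12_def block21_def block22_def

lemma block_mult:
  fixes A B :: "'a::comm_ring_1^('m::finite + 'n::finite)^('m + 'n)"
  shows "block11 (A ** B) = block11 A ** block11 B + block12 A ** block21 B"
    and "block12 (A ** B) = block11 A ** block12 B + block12 A ** block22 B"
    and "block21 (A ** B) = block21 A ** block11 B + block22 A ** block21 B"
    and "block22 (A ** B) = block21 A ** block12 B + block22 A ** block22 B"
  by (simp_all add: block_defs vec_eq_iff matrix_matrix_mult_def sum_UNIV_Plus)

lemma block_add:
  fixes A B :: "'a::comm_ring_1^('m::finite + 'n::finite)^('m + 'n)"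
  shows "block11 (A + B) = block11 A + block11 B" "block12 (A + B) = block12 A + block12 B"
    "block21 (A + B) = block21 A + block21 B" "block22 (A + B) = block22 A + block22 B"
  by (simp_all add: block_defs vec_eq_iff)

lemma block_diff:
  fixes A B :: "'a::comm_ring_1^('m::finite + 'n::finite)^('m + 'n)"
  shows "block11 (A - B) = block11 A - block11 B" "block12 (A - B) = block12 A - block12 B"
    "block21 (A - B) = block21 A - block21 B" "block22 (A - B) = block22 A - block22 B"
  by (simp_all add: block_defs vec_eq_iff)

lemma block_mat:
  "block11 (mat c) = mat c" "block12 (mat c) = 0" "block21 (mat c) = 0" "block22 (mat c) = mat c"
  by (simp_all add: block_defs vec_eq_iff mat_def)

lemma block_proj2:
  "block11 proj2 = 0" "block12 proj2 = 0" "block21 proj2 = 0" "block22 proj2 = mat 1"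
  by (simp_all add: block_defs vec_eq_iff mat_def proj2_def)

lemma block_transpose:
  "block11 (transpose A) = transpose (block11 A)" "block12 (transpose A) = transpose (block21 A)"
  "block21 (transpose A) = transpose (block12 A)" "block22 (transpose A) = transpose (block22 A)"
  by (simp_all add: block_defs vec_eq_iff transpose_def)

lemma block_eqI:
  assumes "block11 A = block11 B" "block12 A = block12 B" "block21 A = block21 B" "block22 A = block22 B"
  shows "A = B"
proof -
  have "A $ k $ l = B $ k $ l" for k l
    using assms by (cases k; cases l) (simp_all add: block_defs vec_eq_iff)
  then show ?thesis by (simp add: vec_eq_iff)
qed

lemma xpart_vector_matrix_mult:
  "xpart (v v* A) = ypart v v* block12 A + xpart v v* block22 A"
  and ypart_vector_matrix_mult:
  "ypart (v v* A) = ypart v v* block11 A + xpart v v* block21 A"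
  for A :: "real^('m::finite + 'n::finite)^('m + 'n)"
  by (simp_all add: xpart_def ypart_def block_defs vec_eq_iff vector_matrix_mult_def sum_UNIV_Plus)

section \<open>Leading coefficients of the determinant and the adjugate of
  \<open>J + a P_2\<close>\<close>

definition pencil :: "real^('m::finite + 'n::finite)^('m + 'n) \<Rightarrow> real poly^('m + 'n)^('m + 'n)" where
  "pencil M = (\<chi> k l. [:M $ k $ l, proj2 $ k $ l:])"

text \<open>The numbers are only bounds for the degrees: moving off the index \<open>m\<close>
  pushes one of the two factors beyond its bound.\<close>

lemma coeff_mult_degree_bounds:
  fixes p q :: "'a::comm_semiring_0 poly"
  assumes "degree p \<le> m" "degree q \<le> n"
  shows "coeff (p * q) (m + n) = coeff p m * coeff q n"
proof -
  have "coeff p i * coeff q (m + n - i) = 0" if "i \<in> {..m + n} - {m}" for i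
    using that assms by (cases "i < m") (auto simp: coeff_eq_0)
  then have "(\<Sum>i\<le>m + n. coeff p i * coeff q (m + n - i))
      = (\<Sum>i\<in>{m}. coeff p i * coeff q (m + n - i))"
    by (intro sum.mono_neutral_right) auto
  then show ?thesis by (simp add: coeff_mult)
qed

lemma coeff_prod_degree_bounds:
  fixes f :: "'i \<Rightarrow> 'a::comm_semiring_1 poly"
  assumes "finite S" "\<And>k. k \<in> S \<Longrightarrow> degree (f k) \<le> e k"
  shows "coeff (\<Prod>k\<in>S. f k) (\<Sum>k\<in>S. e k) = (\<Prod>k\<in>S. coeff (f k) (e k))"
  using assms
proof (induction S rule: finite_induct)
  case (insert k S)
  have "degree (\<Prod>k\<in>S. f k) \<le> (\<Sum>k\<in>S. e k)"
    using degree_prod_sum_le[OF insert.hyps(1), of f] sum_mono[of S "degree \<circ> f" e] insert.prems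
    by (fastforce intro: order_trans)
  with insert show ?case by (simp add: coeff_mult_degree_bounds)
qed simp

text \<open>The rows \<open>Inl\<close> are constant in \<open>a\<close> and the rows
  \<open>Inr\<close> at most linear, so the power n arises only by taking the linear coefficient in
  every row \<open>Inr\<close>.\<close>

lemma coeff_det_pencil:
  fixes M :: "real^('m::finite + 'n::finite)^('m + 'n)"
  shows "coeff (det (pencil M)) CARD('n)
    = det (\<chi> k l. case k of Inl _ \<Rightarrow> M $ k $ l | Inr _ \<Rightarrow> proj2 $ k $ l)"
proof -
  define e :: "'m + 'n \<Rightarrow> nat" where "e k = (case k of Inl _ \<Rightarrow> 0 | Inr _ \<Rightarrow> 1)" for k
  have "(\<Sum>k\<in>UNIV. e k) = CARD('n)" by (simp add: e_def sum_UNIV_Plus)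
  moreover have "degree (pencil M $ k $ l) \<le> e k" for k l
    by (cases k) (auto simp: pencil_def e_def proj2_def)
  ultimately have "coeff (\<Prod>k\<in>UNIV. pencil M $ k $ p k) CARD('n)
      = (\<Prod>k\<in>UNIV. coeff (pencil M $ k $ p k) (e k))" for p
    using coeff_prod_degree_bounds[of UNIV "\<lambda>k. pencil M $ k $ p k" e] by simp
  moreover have "coeff (pencil M $ k $ l) (e k)
      = (case k of Inl _ \<Rightarrow> M $ k $ l | Inr _ \<Rightarrow> proj2 $ k $ l)" for k l
    by (cases k) (simp_all add: pencil_def e_def)
  moreover have "coeff (of_int c * q) i = of_int c * coeff q i" for c i and q :: "real poly"
    by (simp add: of_int_poly)
  ultimately show ?thesis by (simp add: det_def coeff_sum)
qed

text \<open>In the Leibniz sum the unit rows \<open>Inr\<close> kill every permutation that moves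
  some \<open>Inr a\<close>. The others preserve the \<open>Inl\<close> indices and see only the
  first block. This makes the factor \<open>d\<close> of the reduced 1-form locally constant in
  x.\<close>

lemma coeff_det_pencil_cong:
  fixes M M' :: "real^('m::finite + 'n::finite)^('m + 'n)"
  assumes "block11 M = block11 M'"
  shows "coeff (det (pencil M)) CARD('n) = coeff (det (pencil M')) CARD('n)"
proof -
  let ?T = "\<lambda>M :: real^('m + 'n)^('m + 'n). \<lambda>k l. case k of Inl _ \<Rightarrow> M $ k $ l | Inr _ \<Rightarrow> proj2 $ k $ l"
  have "(\<Prod>k\<in>UNIV. ?T M k (p k)) = (\<Prod>k\<in>UNIV. ?T M' k (p k))" if p: "p permutes UNIV" for p
  proof (cases "\<forall>a. p (Inr a) = Inr a")
    case True
    show ?thesis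
    proof (intro prod.cong refl)
      fix k
      show "?T M k (p k) = ?T M' k (p k)"
      proof (cases k)
        case (Inl i)
        have "p (Inl i) \<noteq> Inr a" for a
          using True permutes_inj[OF p] by (metis Inl_Inr_False injD)
        then obtain j where "p (Inl i) = Inl j" by (cases "p (Inl i)") auto
        with assms Inl show ?thesis by (simp add: block11_def vec_eq_iff)
      qed simp
    qed
  next
    case False
    then obtain a where "p (Inr a) \<noteq> Inr a" by blast
    then have "?T M (Inr a) (p (Inr a)) = 0" for M
      by (simp add: proj2_def)
    then have "(\<Prod>k\<in>UNIV. ?T M k (p k)) = 0" for M
      by (intro prod_zero bexI[of _ "Inr a"]) simp_all
    then show ?thesis by metis
  qed
  then show ?thesis unfolding coeff_det_pencil unfolding det_def by simp
qed

text \<open>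
  Compare the coefficients of \<open>a\<^bsup>n+1\<^esup>\<close> and \<open>a\<^sup>n\<close> in the two identities of the matrix
  \<open>J + a P\<^sub>2\<close> and its adjugate: the former leave only the first diagonal block of the coefficient
  \<open>A\<^sub>(\<^sub>n\<^sub>+\<^sub>1\<^sub>)\<close>, and the latter give this block and the last block column of \<open>A\<^sub>(\<^sub>n\<^sub>)\<close>.
\<close>

lemma cof_coeff_card:
  fixes M :: "real^('m::finite + 'n::finite)^('m + 'n)"
  assumes "invertible (block11 M)"
  defines "d \<equiv> coeff (det (pencil M)) CARD('n)"
  shows "block12 (cof_coeff CARD('n) M) = - (d *\<^sub>R (matrix_inv (block11 M) ** block12 M))"
    and "block22 (cof_coeff CARD('n) M) = mat d"
proof -
  \<comment> \<open>Index shift: \<open>C j\<close> belongs to the power j itself and is thus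
    \<open>cof_coeff (j + 1) M\<close>.\<close>
  define C where "C j = (\<chi> r s. coeff (cof (pencil M) $ r $ s) j)" for j
  \<comment> \<open>To the power j + 1 the matrix \<open>M\<close> contributes with
    \<open>C (Suc j)\<close>, and \<open>P_2\<close>, which carries a factor \<open>a\<close>, with
    \<open>C j\<close>.\<close>
  have right: "C (Suc j) ** M + C j ** proj2 = mat (coeff (det (pencil M)) (Suc j))" for j
  proof -
    have "(\<Sum>l\<in>UNIV. cof (pencil M) $ r $ l * [:M $ l $ s, proj2 $ l $ s:])
        = (if r = s then det (pencil M) else 0)" for r s
      using arg_cong[OF cof_mult[of "pencil M"], of "\<lambda>A. A $ r $ s"]
      by (simp add: matrix_matrix_mult_def mat_def pencil_def)
    from arg_cong[OF this, of "\<lambda>p. coeff p (Suc j)"] show ?thesis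
      by (simp add: C_def vec_eq_iff matrix_matrix_mult_def mat_def coeff_sum mult.commute
          sum.distrib if_distrib[of "\<lambda>p. coeff p _"] cong: if_cong)
  qed
  have left: "M ** C (Suc j) + proj2 ** C j = mat (coeff (det (pencil M)) (Suc j))" for j
  proof -
    have "(\<Sum>l\<in>UNIV. [:M $ r $ l, proj2 $ r $ l:] * cof (pencil M) $ l $ s)
        = (if r = s then det (pencil M) else 0)" for r s
      using arg_cong[OF mult_cof[of "pencil M"], of "\<lambda>A. A $ r $ s"]
      by (simp add: matrix_matrix_mult_def mat_def pencil_def)
    from arg_cong[OF this, of "\<lambda>p. coeff p (Suc j)"] show ?thesis
      by (simp add: C_def vec_eq_iff matrix_matrix_mult_def mat_def coeff_sum
          sum.distrib if_distrib[of "\<lambda>p. coeff p _"] cong: if_cong)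
  qed
  define N where "N = CARD('n)"
  have "C (Suc N) = 0"
    using degree_cof_le[of M]
    by (auto simp: C_def N_def vec_eq_iff pencil_def intro!: coeff_eq_0 le_imp_less_Suc)
  then have top_right: "C N ** proj2 = mat (coeff (det (pencil M)) (Suc N))"
    and top_left: "proj2 ** C N = mat (coeff (det (pencil M)) (Suc N))"
    using right[of N] left[of N] by (simp_all add: matrix_mult_zero_left matrix_mult_zero_right)
  have "mat (coeff (det (pencil M)) (Suc N)) = (0 :: real^'m^'m)"
    using arg_cong[OF top_right, of block11]
    by (simp add: block_mult block_proj2 block_mat matrix_mult_zero_right)
  \<comment> \<open>Index types are nonempty, so the vanishing block has a diagonal entry.\<close>
  then have "coeff (det (pencil M)) (Suc N) = 0"
    by (simp add: vec_eq_iff mat_def) metis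
  then have top: "C N ** proj2 = 0" "proj2 ** C N = 0"
    using top_right top_left by (simp_all add: vec_eq_iff mat_def)
  have top12: "block12 (C N) = 0" and top22: "block22 (C N) = 0"
    using arg_cong[OF top(1), of block12] arg_cong[OF top(1), of block22]
    by (simp_all add: block_mult block_proj2 matrix_mult_zero_right) (simp_all add: block_defs vec_eq_iff)
  have top21: "block21 (C N) = 0"
    using arg_cong[OF top(2), of block21]
    by (simp add: block_mult block_proj2 matrix_mult_zero_left) (simp add: block_defs vec_eq_iff)
  \<comment> \<open>Since \<open>'n\<close> is nonempty, \<open>right\<close> at
    \<open>N - 1\<close> is the comparison at the power n, the one with \<open>d\<close> on the
    right-hand side.\<close>
  have "N = Suc (N - 1)" by (simp add: N_def)
  then have second: "C N ** M + C (N - 1) ** proj2 = mat d"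
    using right[of "N - 1"] unfolding d_def N_def by simp
  have "block11 (C N) ** block11 M = mat d"
    using arg_cong[OF second, of block11]
    by (simp add: block_add block_mult block_proj2 block_mat top12 matrix_mult_zero_left matrix_mult_zero_right)
  then have "block11 (C N) ** (block11 M ** matrix_inv (block11 M)) = mat d ** matrix_inv (block11 M)"
    by (simp add: matrix_mul_assoc)
  moreover have "mat d ** A = d *\<^sub>R A" for A :: "real^'m^'m"
    by (simp add: vec_eq_iff matrix_matrix_mult_def mat_def if_distrib[of "\<lambda>x. x * _"] cong: if_cong)
  ultimately have "block11 (C N) = d *\<^sub>R matrix_inv (block11 M)"
    using assms(1) by (simp add: matrix_inv_right)
  moreover have "C (N - 1) = cof_coeff CARD('n) M"
    by (simp add: C_def N_def cof_coeff_def pencil_def)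
  ultimately show "block12 (cof_coeff CARD('n) M) = - (d *\<^sub>R (matrix_inv (block11 M) ** block12 M))"
    and "block22 (cof_coeff CARD('n) M) = mat d"
    using arg_cong[OF second, of block12] arg_cong[OF second, of block22]
    by (simp_all add: block_add block_mult block_proj2 block_mat top12 top21 top22
        matrix_mult_zero_left matrix_mult_zero_right matrix_mult_scaleR_left add_eq_0_iff)
qed

text \<open>A kernel vector \<open>v\<close> of the Schur complement extends to the kernel vector
  \<open>join u v\<close> of \<open>M\<close>, where \<open>u\<close> solves the first block
  row.\<close>

lemma invertible_Jbar2:
  fixes M :: "real^('m::finite + 'n::finite)^('m + 'n)"
  assumes "invertible M" "invertible (block11 M)"
  shows "invertible (Jbar2 M)"
proof -
  have "v = 0" if v: "Jbar2 M *v v = 0" for v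
  proof -
    define u where "u = - (matrix_inv (block11 M) *v (block12 M *v v))"
    have M: "M *v w = join (block11 M *v ypart w + block12 M *v xpart w)
        (block21 M *v ypart w + block22 M *v xpart w)" for w
      by (auto simp: vec_eq_iff join_def matrix_vector_mult_def block_defs ypart_def xpart_def
          sum_UNIV_Plus split: sum.split)
    have j: "ypart (join a b) = a" "xpart (join a b) = b" for a :: "real^'m" and b :: "real^'n"
      by (simp_all add: vec_eq_iff ypart_def xpart_def join_def)
    have "block11 M *v u + block12 M *v v = 0"
      by (simp add: u_def linear_neg[OF matrix_vector_mul_linear] matrix_vector_mul_assoc
          matrix_mul_assoc matrix_inv_right assms)
    moreover have "block21 M *v u + block22 M *v v = 0"
      using v by (simp add: u_def Jbar2_def linear_neg[OF matrix_vector_mul_linear] matrix_vector_mul_assoc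
          matrix_mul_assoc matrix_vector_mult_diff_rdistrib)
    ultimately have "M *v join u v = 0"
      by (simp add: M j) (simp add: vec_eq_iff join_def split: sum.split)
    then have "join u v = 0"
      using assms(1) by (simp add: invertible_left_inverse matrix_left_invertible_ker)
    then show "v = 0" using j(2)[of u v] by (simp add: vec_eq_iff xpart_def)
  qed
  then show ?thesis by (simp add: invertible_left_inverse matrix_left_invertible_ker)
qed

subsection \<open>Slices of a driven cofactor system\<close>

lemma ypart_join [simp]: "ypart (join y x) = y"
  and xpart_join [simp]: "xpart (join y x) = x"
  by (simp_all add: vec_eq_iff ypart_def xpart_def join_def)

lemma ypart_line: "ypart (z + t *\<^sub>R axis (Inr c) (1::real)) = ypart z"
  and xpart_line: "xpart (z + t *\<^sub>R axis (Inl i) (1::real)) = xpart z"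
  by (simp_all add: vec_eq_iff ypart_def xpart_def axis_def)

lemma join_axis: "join 0 (axis c 1) = axis (Inr c) 1"
  by (simp add: vec_eq_iff join_def axis_def split: sum.split)

lemma bounded_linear_join: "bounded_linear (join 0 :: real^'n \<Rightarrow> real^('m::finite + 'n::finite))"
  unfolding linear_conv_bounded_linear[symmetric]
  by (rule linearI) (simp_all add: vec_eq_iff join_def split: sum.split)

lemma has_derivative_join:
  fixes y :: "real^'m::finite" and x :: "real^'n::finite"
  shows "(join y has_derivative join 0) (at x)"
proof -
  have "((\<lambda>x. join y 0 + join 0 x) has_derivative (\<lambda>v. 0 + join 0 v)) (at x)"
    by (intro has_derivative_add has_derivative_const
        bounded_linear_imp_has_derivative bounded_linear_join)
  moreover have "join y 0 + join 0 x = join y x" for x :: "real^'n"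
    by (simp add: vec_eq_iff join_def split: sum.split)
  ultimately show ?thesis by simp
qed

lemma bounded_linear_parts:
  "bounded_linear (ypart :: real^('m::finite + 'n::finite) \<Rightarrow> _)"
  "bounded_linear (xpart :: real^('m::finite + 'n::finite) \<Rightarrow> _)"
  unfolding linear_conv_bounded_linear[symmetric]
  by (rule linearI; simp add: vec_eq_iff ypart_def xpart_def)+

lemma bounded_linear_blocks:
  "bounded_linear (block11 :: real^('m::finite + 'n::finite)^('m + 'n) \<Rightarrow> _)"
  "bounded_linear (block12 :: real^('m::finite + 'n::finite)^('m + 'n) \<Rightarrow> _)"
  "bounded_linear (block21 :: real^('m::finite + 'n::finite)^('m + 'n) \<Rightarrow> _)"
  "bounded_linear (block22 :: real^('m::finite + 'n::finite)^('m + 'n) \<Rightarrow> _)"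
  unfolding linear_conv_bounded_linear[symmetric]
  by (rule linearI; simp add: vec_eq_iff block_defs)+

section \<open>Restriction of maps to the slice over a fixed \<open>y\<close>\<close>

lemma open_slice:
  fixes U :: "(real^('m::finite + 'n::finite)) set"
  assumes "open U"
  shows "open {x. join y x \<in> U}"
proof -
  have "continuous_on UNIV (join y :: real^'n \<Rightarrow> real^('m + 'n))"
    using has_derivative_join by (intro has_derivative_continuous_on) (auto intro: has_derivative_at_withinI)
  from open_vimage[OF assms this] show ?thesis by (simp add: vimage_def)
qed

lemma
  fixes f :: "real^('m::finite + 'n::finite) \<Rightarrow> 'a::real_normed_vector"
  assumes "f differentiable (at (join y x))"
  shows differentiable_slice: "(\<lambda>x. f (join y x)) differentiable (at x)"
    and partial_slice: "partial c (\<lambda>x. f (join y x)) x = partial (Inr c) f (join y x)"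
proof -
  have d: "((\<lambda>x. f (join y x)) has_derivative (\<lambda>v. frechet_derivative f (at (join y x)) (join 0 v))) (at x)"
    using diff_chain_at[OF has_derivative_join assms[unfolded frechet_derivative_works]]
    by (simp add: o_def)
  then show "(\<lambda>x. f (join y x)) differentiable (at x)" by (rule differentiableI)
  show "partial c (\<lambda>x. f (join y x)) x = partial (Inr c) f (join y x)"
    using partial_eqI[OF d] by (simp add: join_axis partial_def)
qed

lemma Ck_on_slice:
  fixes U :: "(real^('m::finite + 'n::finite)) set"
  assumes "open U"
  shows "Ck_on r U f \<Longrightarrow> Ck_on r {x. join y x \<in> U} (\<lambda>x. f (join y x))"
proof (induction r arbitrary: f)
  case 0
  have "continuous_on {x. join y x \<in> U} (join y)"
    using has_derivative_join by (intro has_derivative_continuous_on) (auto intro: has_derivative_at_withinI)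
  with 0 show ?case by (auto intro: continuous_on_compose2)
next
  case (Suc r)
  have "Ck_on r {x. join y x \<in> U} (partial c (\<lambda>x. f (join y x)))" for c
    using Suc.prems Suc.IH[of "partial (Inr c) f"]
    by (subst Ck_on_cong[OF open_slice[OF assms], of _ _ "\<lambda>x. partial (Inr c) f (join y x)"])
      (auto simp: partial_slice)
  then show ?case using Suc.prems by (auto intro: differentiable_slice)
qed

lemma smooth_on_slice:
  fixes U :: "(real^('m::finite + 'n::finite)) set"
  shows "open U \<Longrightarrow> smooth_on U f \<Longrightarrow> smooth_on {x. join y x \<in> U} (\<lambda>x. f (join y x))"
  by (simp add: smooth_on_def Ck_on_slice)

text \<open>The conclusion is local because a slice may be disconnected. This is enough, as the
  equations to be proved concern derivatives at single points.\<close>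

lemma partials_zero_imp_locally_constant:
  fixes f :: "real^'k \<Rightarrow> 'a::real_normed_vector"
  assumes "open S" "x0 \<in> S" "\<And>x. x \<in> S \<Longrightarrow> f differentiable (at x)"
    "\<And>x c. x \<in> S \<Longrightarrow> partial c f x = 0"
  obtains T where "open T" "x0 \<in> T" "T \<subseteq> S" "\<And>x. x \<in> T \<Longrightarrow> f x = f x0"
proof -
  obtain e where e: "e > 0" "ball x0 e \<subseteq> S" using assms(1,2) open_contains_ball by blast
  have "(f has_derivative (\<lambda>h. 0)) (at x within ball x0 e)" if "x \<in> ball x0 e" for x
  proof -
    have x: "x \<in> S" using that e by blast
    have lin: "linear (frechet_derivative f (at x))"
      using assms(3)[OF x] by (rule linear_frechet_derivative)
    have "frechet_derivative f (at x) h = 0" for h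
    proof -
      have "h = (\<Sum>c\<in>UNIV. h $ c *\<^sub>R axis c 1)"
        by (simp add: vec_eq_iff axis_def if_distrib cong: if_cong)
      then have "frechet_derivative f (at x) h
          = frechet_derivative f (at x) (\<Sum>c\<in>UNIV. h $ c *\<^sub>R axis c 1)"
        by (rule arg_cong)
      also have "\<dots> = (\<Sum>c\<in>UNIV. h $ c *\<^sub>R partial c f x)"
        by (simp add: linear_sum[OF lin] linear_cmul[OF lin] partial_def)
      finally show ?thesis using assms(4)[OF x] by simp
    qed
    then have "frechet_derivative f (at x) = (\<lambda>h. 0)" by (rule ext)
    with assms(3)[OF x] show ?thesis
      by (simp add: frechet_derivative_works has_derivative_at_withinI)
  qed
  then obtain c where "\<And>x. x \<in> ball x0 e \<Longrightarrow> f x = c"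
    using has_derivative_zero_constant[OF convex_ball] by metis
  with e show ?thesis by (intro that[of "ball x0 e"]) auto
qed

section \<open>Outer and wedge products\<close>

definition outer :: "real^'i \<Rightarrow> real^'j \<Rightarrow> real^'j^'i" where
  "outer a b = (\<chi> i j. a $ i * b $ j)"

lemma matrix_mult_outer: "M ** outer a b = outer (M *v a) b"
  by (simp add: outer_def vec_eq_iff matrix_matrix_mult_def matrix_vector_mult_def
      sum_distrib_left mult_ac)

lemma outer_matrix_mult: "outer a b ** M = outer a (b v* M)"
  by (simp add: outer_def vec_eq_iff matrix_matrix_mult_def vector_matrix_mult_def sum_distrib_left mult_ac)

lemma vector_matrix_mult_outer: "v v* outer a b = (v \<bullet> a) *\<^sub>R b"
  by (simp add: outer_def vec_eq_iff vector_matrix_mult_def inner_vec_def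
      sum_distrib_left mult_ac)

text \<open>Meant for \<open>b\<close> a column of the block metric in an x-direction, which has no
  y-components.\<close>

lemma block_sym_prod:
  fixes a b :: "real^('m::finite + 'n::finite)"
  assumes "ypart b = 0"
  shows "block11 (sym_prod a b) = 0" "block12 (sym_prod a b) = (1/2) *\<^sub>R outer (ypart a) (xpart b)"
    "block21 (sym_prod a b) = (1/2) *\<^sub>R outer (xpart b) (ypart a)"
    "block22 (sym_prod a b) = sym_prod (xpart a) (xpart b)"
  using assms
  by (simp_all add: sym_prod_def outer_def block_defs vec_eq_iff ypart_def xpart_def)

lemma block22_wedge: "block22 (wedge a b) = wedge (xpart a) (xpart b)"
  by (simp add: block22_def wedge_def xpart_def vec_eq_iff)

lemma wedge_congruence: "transpose E ** wedge a b ** E = wedge (a v* E) (b v* E)"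
proof -
  have w: "wedge a b = outer a b - outer b a" for a b :: "real^'c"
    by (simp add: wedge_def outer_def vec_eq_iff mult.commute)
  show ?thesis
    by (simp add: w matrix_mult_diff_left matrix_mult_diff_right matrix_mult_outer outer_matrix_mult)
qed

lemma wedge_scaleR_right: "wedge a (c *\<^sub>R b) = c *\<^sub>R wedge a b"
  by (simp add: wedge_def vec_eq_iff algebra_simps)

text \<open>Fixes one \<open>y\<close> and gathers what the slice over it inherits. \<open>q\<close>
  is the value of \<mu>_1 there, a single covector because \<mu>_1 depends on y only.\<close>

locale driven_slice =
  fixes U :: "(real^('m::finite + 'n::finite)) set"
    and g :: "real^('m + 'n) \<Rightarrow> real^('m + 'n)^('m + 'n)"
    and g1 :: "real^'m \<Rightarrow> real^'m^'m"
    and g2 :: "real^'n \<Rightarrow> real^'n^'n"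
    and \<mu> :: "real^('m + 'n) \<Rightarrow> real^('m + 'n)"
    and J :: "real^('m + 'n) \<Rightarrow> real^('m + 'n)^('m + 'n)"
    and y q :: "real^'m"
  assumes system: "cofactor_system U g \<mu> J"
    and metric_blocks: "\<And>z. z \<in> U \<Longrightarrow> block11 (g z) = g1 (ypart z)"
      "\<And>z. z \<in> U \<Longrightarrow> block22 (g z) = g2 (xpart z)"
      "\<And>z. z \<in> U \<Longrightarrow> block12 (g z) = 0" "\<And>z. z \<in> U \<Longrightarrow> block21 (g z) = 0"
    and ypart_\<mu>: "\<And>x. join y x \<in> U \<Longrightarrow> ypart (\<mu> (join y x)) = q"
    and inv_J1: "\<And>z. z \<in> U \<Longrightarrow> invertible (block11 (J z))"
begin

lemma open_U: "open U" and metric: "riemannian_metric_on U g" and sckt: "sckt_on U g J"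
  and smooth_\<mu>: "smooth_on U \<mu>" and DJ1_\<mu>: "\<And>z. z \<in> U \<Longrightarrow> DJ1 J \<mu> z = 0"
  and inv_J: "\<And>z. z \<in> U \<Longrightarrow> invertible (J z)"
  and smooth_J: "smooth_on U J" and smooth_g: "smooth_on U g"
  using system by (auto simp: cofactor_system_def sckt_on_def riemannian_metric_on_def)

abbreviation S where "S \<equiv> {x. join y x \<in> U}"

lemmas open_S = open_slice[OF open_U, of y]
lemmas J_differentiable = smooth_on_imp_differentiable[OF smooth_J]
lemmas g_differentiable = smooth_on_imp_differentiable[OF smooth_g]
lemmas \<mu>_differentiable = smooth_on_imp_differentiable[OF smooth_\<mu>]

lemma g_nth_differentiable: "z \<in> U \<Longrightarrow> (\<lambda>w. g w $ k $ l) differentiable (at z)"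
  by (rule differentiable_bounded_linear[OF bounded_linear_nth_nth g_differentiable])

section \<open>Metric and connection on the slice\<close>

lemma metric_mixed: "z \<in> U \<Longrightarrow> g z $ Inl i $ Inr a = 0" "z \<in> U \<Longrightarrow> g z $ Inr a $ Inl i = 0"
  using metric_blocks(3,4)[of z] by (simp_all add: block_defs vec_eq_iff)

lemma metric_nth: "z \<in> U \<Longrightarrow> g z $ Inl i $ Inl j = g1 (ypart z) $ i $ j"
  "z \<in> U \<Longrightarrow> g z $ Inr a $ Inr b = g2 (xpart z) $ a $ b"
  using metric_blocks(1,2)[of z] by (simp_all add: block_defs vec_eq_iff)

lemma riemannian_metric_slice: "riemannian_metric_on S g2"
proof -
  have "smooth_on S (\<lambda>x. block22 (g (join y x)))"
    by (intro smooth_on_slice open_U smooth_on_bounded_linear[OF open_U bounded_linear_blocks(4) smooth_g])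
  then have "smooth_on S g2"
    by (subst smooth_on_cong[OF open_S, of _ "\<lambda>x. block22 (g (join y x))"])
      (auto simp: metric_blocks)
  moreover have "transpose (g2 x) = g2 x" if "x \<in> S" for x
    using metric that by (metis (mono_tags, lifting) block_transpose(4) mem_Collect_eq
        metric_blocks(2) riemannian_metric_on_def xpart_join)
  moreover have "v \<bullet> (g2 x *v v) > 0" if x: "x \<in> S" and v: "v \<noteq> 0" for x v
  proof -
    have "join 0 v \<noteq> (0 :: real^('m + 'n))"
      using v by (metis linear_0 bounded_linear.linear bounded_linear_parts(2) xpart_join)
    then have "join 0 v \<bullet> (g (join y x) *v join 0 v) > 0"
      using metric x by (simp add: riemannian_metric_on_def)
    also have "join 0 v \<bullet> (g (join y x) *v join 0 v) = v \<bullet> (g2 x *v v)"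
      using x by (simp add: inner_vec_def matrix_vector_mult_def sum_UNIV_Plus join_def metric_nth)
        (simp add: join_def[symmetric])
    finally show ?thesis .
  qed
  ultimately show ?thesis by (simp add: riemannian_metric_on_def)
qed

text \<open>In the direction of x^c every first-kind symbol with a y-index vanishes: mixed entries
  of the metric are zero and each diagonal block depends on its own coordinates only.\<close>

lemma conn_blocks:
  fixes x :: "real^'n" and c :: 'n
  assumes "x \<in> S"
  defines "\<omega> \<equiv> conn g (Inr c) (join y x)"
  shows "block11 \<omega> = 0" "block12 \<omega> = 0" "block21 \<omega> = 0" "block22 \<omega> = conn g2 c x"
proof -
  let ?z = "join y x"
  have z: "?z \<in> U" using assms by simp
  have mixed: "partial k (\<lambda>w. g w $ Inl i $ Inr a) ?z = 0"
    "partial k (\<lambda>w. g w $ Inr a $ Inl i) ?z = 0" for k i a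
    using partial_cong_open[OF open_U z metric_mixed(1)] partial_cong_open[OF open_U z metric_mixed(2)]
    by (simp_all add: partial_const)
  have p1: "partial (Inr c) (\<lambda>w. g w $ Inl i $ Inl j) ?z = 0" for c i j
  proof -
    have "\<forall>\<^sub>F t in nhds 0. g (?z + t *\<^sub>R axis (Inr c) 1) $ Inl i $ Inl j = g1 y $ i $ j"
      using eventually_line_mem[OF open_U z, of "Inr c"] by eventually_elim (simp add: metric_nth ypart_line)
    from partial_cong_along[OF g_nth_differentiable[OF z] differentiable_const this]
    show ?thesis by (simp add: partial_const)
  qed
  have p2: "partial (Inl k) (\<lambda>w. g w $ Inr a $ Inr b) ?z = 0" for k a b
  proof -
    have "\<forall>\<^sub>F t in nhds 0. g (?z + t *\<^sub>R axis (Inl k) 1) $ Inr a $ Inr b = g2 x $ a $ b"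
      using eventually_line_mem[OF open_U z, of "Inl k"] by eventually_elim (simp add: metric_nth xpart_line)
    from partial_cong_along[OF g_nth_differentiable[OF z] differentiable_const this]
    show ?thesis by (simp add: partial_const)
  qed
  have p3: "partial (Inr c) (\<lambda>w. g w $ Inr a $ Inr b) ?z = partial c (\<lambda>x. g2 x $ a $ b) x" for c a b
    unfolding partial_slice[OF g_nth_differentiable[OF z], symmetric]
    by (rule partial_cong_open[OF open_S assms(1)]) (simp add: metric_nth)
  \<comment> \<open>The expected value of \<omega>: the connection of \<open>g2\<close> extended by
    zero. Comparing after multiplication by the metric leaves only first-kind symbols; invertibility
    then gives equality.\<close>
  define \<Omega> :: "real^('m + 'n)^('m + 'n)" where
    "\<Omega> = (\<chi> k l. case k of Inl _ \<Rightarrow> 0 | Inr a \<Rightarrow> (case l of Inl _ \<Rightarrow> 0 | Inr b \<Rightarrow> conn g2 c x $ a $ b))"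
  have \<Omega>: "block11 \<Omega> = 0" "block12 \<Omega> = 0" "block21 \<Omega> = 0" "block22 \<Omega> = conn g2 c x"
    by (simp_all add: \<Omega>_def block_defs vec_eq_iff)
  have "g ?z ** \<omega> = g ?z ** \<Omega>"
  proof (rule block_eqI)
    show "block11 (g ?z ** \<omega>) = block11 (g ?z ** \<Omega>)"
      by (simp add: block_mult(1)[of _ \<Omega>] \<Omega> matrix_mult_zero_right \<omega>_def metric_mult_conn[OF metric z])
       (simp add: block_defs vec_eq_iff mixed p1)
    show "block12 (g ?z ** \<omega>) = block12 (g ?z ** \<Omega>)"
      by (simp add: block_mult(2)[of _ \<Omega>] \<Omega> matrix_mult_zero_right metric_blocks[OF z]
          matrix_mult_zero_left \<omega>_def metric_mult_conn[OF metric z])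
       (simp add: block_defs vec_eq_iff mixed p2)
    show "block21 (g ?z ** \<omega>) = block21 (g ?z ** \<Omega>)"
      by (simp add: block_mult(3)[of _ \<Omega>] \<Omega> matrix_mult_zero_right \<omega>_def metric_mult_conn[OF metric z])
       (simp add: block_defs vec_eq_iff mixed p2)
    show "block22 (g ?z ** \<omega>) = block22 (g ?z ** \<Omega>)"
      by (simp add: block_mult(4)[of _ \<Omega>] \<Omega> matrix_mult_zero_right metric_blocks[OF z]
          \<omega>_def metric_mult_conn[OF metric z] metric_mult_conn[OF riemannian_metric_slice assms(1)])
       (simp add: block_defs vec_eq_iff p3)
  qed
  then have "matrix_inv (g ?z) ** g ?z ** \<omega> = matrix_inv (g ?z) ** g ?z ** \<Omega>"
    by (simp add: matrix_mul_assoc[symmetric])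
  then have "\<omega> = \<Omega>"
    using riemannian_metric_invertible[OF metric z] by (simp add: matrix_inv_left)
  with \<Omega> show "block11 \<omega> = 0" "block12 \<omega> = 0" "block21 \<omega> = 0" "block22 \<omega> = conn g2 c x" by simp_all
qed

lemma g1_sym: "x \<in> S \<Longrightarrow> transpose (g1 y) = g1 y"
  using metric block_transpose(1)[of "g (join y x)"] metric_blocks(1)[of "join y x"]
  by (auto simp: riemannian_metric_on_def)

lemma g2_sym: "x \<in> S \<Longrightarrow> transpose (g2 x) = g2 x"
  using riemannian_metric_slice by (simp add: riemannian_metric_on_def)

lemma g1_invertible:
  assumes "x \<in> S"
  shows "invertible (g1 y)"
proof -
  have z: "join y x \<in> U" using assms by simp
  have "g (join y x) ** matrix_inv (g (join y x)) = mat 1"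
    using riemannian_metric_invertible[OF metric z] by (rule matrix_inv_right)
  from arg_cong[OF this, of block11]
  have "g1 y ** block11 (matrix_inv (g (join y x))) = mat 1"
    by (simp add: block_mult block_mat metric_blocks[OF z] matrix_mult_zero_left)
  then show ?thesis by (auto simp: invertible_right_inverse)
qed

section \<open>The scKt equation for the Schur complement\<close>

text \<open>
  On the slice, \<open>\<beta>\<close> is the differential of the trace of \<open>Jb\<close>, and the 1-form of the reduced
  system is a locally constant multiple of \<open>\<nu>\<close>.
\<close>

definition "A x = block11 (J (join y x))"
definition "B x = block12 (J (join y x))"
definition "C x = block21 (J (join y x))"
definition "D x = block22 (J (join y x))"
definition "K x = matrix_inv (A x)"
definition "\<alpha> x = differential (\<lambda>w. trace (J w)) (join y x)"
definition "\<beta> x = xpart (\<alpha> x) - ypart (\<alpha> x) v* (K x ** B x)"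
definition "\<nu> x = xpart (\<mu> (join y x)) - q v* (K x ** B x)"
definition "Jb x = Jbar2 (J (join y x))"

lemma Jb_eq: "Jb x = D x - C x ** K x ** B x"
  by (simp add: Jb_def Jbar2_def A_def B_def C_def D_def K_def)

lemma blocks_differentiable:
  assumes "x \<in> S"
  shows "A differentiable (at x)" "B differentiable (at x)" "C differentiable (at x)" "D differentiable (at x)"
  using bounded_linear_blocks[THEN differentiable_bounded_linear, OF J_differentiable] assms
  unfolding A_def B_def C_def D_def by (auto intro!: differentiable_slice)

lemma partial_blocks:
  assumes "x \<in> S"
  shows "partial c A x = block11 (partial (Inr c) J (join y x))"
    "partial c B x = block12 (partial (Inr c) J (join y x))"
    "partial c C x = block21 (partial (Inr c) J (join y x))"
    "partial c D x = block22 (partial (Inr c) J (join y x))"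
proof -
  have J: "J differentiable (at (join y x))" using J_differentiable assms by simp
  note * = bounded_linear_blocks[THEN differentiable_bounded_linear, OF J]
  show "partial c A x = block11 (partial (Inr c) J (join y x))"
    "partial c B x = block12 (partial (Inr c) J (join y x))"
    "partial c C x = block21 (partial (Inr c) J (join y x))"
    "partial c D x = block22 (partial (Inr c) J (join y x))"
    unfolding A_def B_def C_def D_def
    by (simp_all add: partial_slice[OF *(1)] partial_slice[OF *(2)] partial_slice[OF *(3)] partial_slice[OF *(4)]
       bounded_linear_blocks[THEN partial_bounded_linear, OF J])
qed

text \<open>Blocks of the symmetry of \<open>g J\<close>; the middle equation says that
  \<open>C x\<close> is the adjoint of \<open>B x\<close> with respect to \<open>g1\<close> and
  \<open>g2\<close>.\<close>

lemma lowered_blocks: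
  assumes "x \<in> S"
  shows "transpose (g1 y ** A x) = g1 y ** A x" "g2 x ** C x = transpose (g1 y ** B x)"
    "transpose (g2 x ** D x) = g2 x ** D x"
proof -
  have z: "join y x \<in> U" using assms by simp
  have sym: "transpose (g (join y x) ** J (join y x)) = g (join y x) ** J (join y x)"
    using sckt z by (simp add: sckt_on_def)
  show "transpose (g1 y ** A x) = g1 y ** A x" "g2 x ** C x = transpose (g1 y ** B x)"
    "transpose (g2 x ** D x) = g2 x ** D x"
    using arg_cong[OF sym, of block11] arg_cong[OF sym, of block21] arg_cong[OF sym, of block22]
    unfolding block_transpose block_mult metric_blocks[OF z] A_def B_def C_def D_def
    by (simp_all add: matrix_mult_zero_left)
qed

text \<open>In an x-direction the connection has only its (2,2) block and the metric column only
  x-components. Hence the (1,1) block of the right-hand side is zero, which makes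
  \<open_placeholder> vanish.\<close>

lemma sckt_blocks:
  assumes "x \<in> S"
  defines "p \<equiv> \<lambda>c. column c (g2 x)"
  shows "partial c A x = 0"
    "g1 y ** (partial c B x - B x ** conn g2 c x) = (1/2) *\<^sub>R outer (ypart (\<alpha> x)) (p c)"
    "g2 x ** (partial c C x + conn g2 c x ** C x) = (1/2) *\<^sub>R outer (p c) (ypart (\<alpha> x))"
    "g2 x ** endo_deriv g2 D c x = sym_prod (xpart (\<alpha> x)) (p c)"
proof -
  let ?z = "join y x"
  have z: "?z \<in> U" using assms by simp
  have col: "ypart (column (Inr c) (g ?z)) = 0" "xpart (column (Inr c) (g ?z)) = p c"
    using metric_mixed[OF z] metric_nth[OF z, unfolded ypart_join xpart_join]
    unfolding p_def ypart_def xpart_def column_def by (simp_all add: vec_eq_iff)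
  have eq: "g ?z ** endo_deriv g J (Inr c) ?z = sym_prod (\<alpha> x) (column (Inr c) (g ?z))"
    using sckt z unfolding sckt_on_iff[OF open_U metric] \<alpha>_def by blast
  note eqs = arg_cong[OF eq, of block11] arg_cong[OF eq, of block12]
     arg_cong[OF eq, of block21] arg_cong[OF eq, of block22]
  note simps = block_mult metric_blocks[OF z] block_sym_prod[OF col(1)] col(2) endo_deriv_def
    block_add block_diff conn_blocks[OF assms(1)] matrix_mult_zero_left matrix_mult_zero_right
    partial_blocks[OF assms(1)] A_def B_def C_def D_def
  have "g1 y ** partial c A x = 0" using eqs(1) by (simp add: simps)
  then have "matrix_inv (g1 y) ** g1 y ** partial c A x = 0"
    by (simp add: matrix_mul_assoc[symmetric] matrix_mult_zero_right)
  then show "partial c A x = 0"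
    using g1_invertible[OF assms(1)] by (simp add: matrix_inv_left)
  show "g1 y ** (partial c B x - B x ** conn g2 c x) = (1/2) *\<^sub>R outer (ypart (\<alpha> x)) (p c)"
    using eqs(2) by (simp add: simps)
  show "g2 x ** (partial c C x + conn g2 c x ** C x) = (1/2) *\<^sub>R outer (p c) (ypart (\<alpha> x))"
    using eqs(3) by (simp add: simps)
  show "g2 x ** endo_deriv g2 D c x = sym_prod (xpart (\<alpha> x)) (p c)"
    using eqs(4) by (simp add: simps)
qed

lemma A_locally_constant:
  assumes "x0 \<in> S"
  obtains T where "open T" "x0 \<in> T" "T \<subseteq> S" "\<And>x. x \<in> T \<Longrightarrow> A x = A x0"
  using partials_zero_imp_locally_constant[OF open_S assms blocks_differentiable(1) sckt_blocks(1)]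
  by blast

lemma A_inv: "x \<in> S \<Longrightarrow> A x ** K x = mat 1" "x \<in> S \<Longrightarrow> K x ** A x = mat 1"
  by (simp_all add: A_def K_def matrix_inv_left matrix_inv_right inv_J1)

text \<open>The inverse of a \<open>g1\<close>-self-adjoint matrix is self-adjoint: multiply the
  symmetry of \<open>g1 y ** A x\<close> by \<open>K x\<close> on the right and its transpose on the
  left.\<close>

lemma g1_K:
  assumes "x \<in> S"
  shows "g1 y ** K x = transpose (K x) ** g1 y"
proof -
  have "transpose (K x) ** (transpose (g1 y ** A x)) ** K x = transpose (K x) ** (g1 y ** A x) ** K x"
    using lowered_blocks(1)[OF assms] by simp
  moreover have "transpose (K x) ** transpose (A x) = mat 1"
    using A_inv(1)[OF assms] by (metis matrix_transpose_mul transpose_mat)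
  ultimately show ?thesis
    using A_inv[OF assms] g1_sym[OF assms]
    by (simp add: matrix_transpose_mul matrix_mul_assoc) (simp add: matrix_mul_assoc[symmetric])
qed

text \<open>\<open>C x ** K x\<close> is the adjoint of \<open>K x ** B x\<close>; this exchanges
  \<open>g2\<close> for \<open>g1\<close>, the metric occurring in the derivative equation of
  \<open>B\<close>.\<close>

lemma g2_C_K:
  assumes "x \<in> S"
  shows "g2 x ** C x ** K x = transpose (K x ** B x) ** g1 y"
proof -
  have "g2 x ** C x ** K x = transpose (B x) ** (g1 y ** K x)"
    by (simp add: lowered_blocks(2)[OF assms] matrix_transpose_mul g1_sym[OF assms] matrix_mul_assoc)
  then show ?thesis by (simp add: g1_K[OF assms] matrix_transpose_mul matrix_mul_assoc)
qed

lemma lowered_Jb_sym: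
  assumes "x \<in> S"
  shows "transpose (g2 x ** Jb x) = g2 x ** Jb x"
proof -
  have "g2 x ** Jb x = g2 x ** D x - transpose (K x ** B x) ** (g1 y ** B x)"
    by (simp add: Jb_eq matrix_mult_diff_right matrix_mul_assoc g2_C_K[OF assms])
  moreover have "transpose (K x ** B x) ** (g1 y ** B x) = transpose (B x) ** (g1 y ** K x) ** B x"
    by (simp add: matrix_transpose_mul matrix_mul_assoc g1_K[OF assms])
  moreover have "transpose (transpose (B x) ** (g1 y ** K x) ** B x) = transpose (B x) ** (g1 y ** K x) ** B x"
    by (simp add: matrix_transpose_mul g1_sym[OF assms] g1_K[OF assms] matrix_mul_assoc)
  moreover have "transpose (X - Y) = transpose X - transpose Y" for X Y :: "real^'n^'n"
    by (simp add: transpose_def vec_eq_iff)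
  ultimately show ?thesis by (simp add: lowered_blocks(3)[OF assms])
qed

lemma endo_deriv_Jb:
  assumes x0: "x0 \<in> S"
  shows "g2 x0 ** endo_deriv g2 Jb c x0 = sym_prod (\<beta> x0) (column c (g2 x0))"
proof -
  let ?p = "column c (g2 x0)" and ?\<omega> = "conn g2 c x0" and ?K = "K x0"
  obtain T where T: "open T" "x0 \<in> T" "T \<subseteq> S" "\<And>x. x \<in> T \<Longrightarrow> A x = A x0"
    using A_locally_constant[OF x0] by blast
  have "partial c Jb x0 = partial c (\<lambda>x. D x - C x ** ?K ** B x) x0"
    \<comment> \<open>Near \<open>x0\<close> the inverse block may be frozen at its value there, so
      the product rule differentiates only \<open>B\<close>, \<open>C\<close> and
      \<open>D\<close>.\<close>
    by (rule partial_cong_open[OF T(1,2)]) (simp add: Jb_eq K_def T(4))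
  also have "\<dots> = partial c D x0 - (C x0 ** ?K ** partial c B x0 + partial c C x0 ** ?K ** B x0)"
    using blocks_differentiable[OF x0]
    by (simp add: partial_diff partial_matrix_mult differentiable_matrix_mult partial_const
        matrix_mult_zero_right)
  \<comment> \<open>The two connection terms of the product \<open>C K B\<close> are shared out: the
    left one completes the derivative of \<open>C\<close>, the right one that of
    \<open>B\<close>.\<close>
  finally have "endo_deriv g2 Jb c x0 = endo_deriv g2 D c x0
      - (partial c C x0 + ?\<omega> ** C x0) ** (?K ** B x0)
      - C x0 ** ?K ** (partial c B x0 - B x0 ** ?\<omega>)"
    by (simp add: endo_deriv_def Jb_eq matrix_mult_add_left matrix_mult_add_right matrix_mult_diff_left
        matrix_mult_diff_right matrix_mul_assoc)
  then have "g2 x0 ** endo_deriv g2 Jb c x0 = g2 x0 ** endo_deriv g2 D c x0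
      - (g2 x0 ** (partial c C x0 + ?\<omega> ** C x0)) ** (?K ** B x0)
      - (g2 x0 ** C x0 ** ?K) ** (partial c B x0 - B x0 ** ?\<omega>)"
    by (simp add: matrix_mult_diff_right matrix_mul_assoc)
  moreover have "(g2 x0 ** C x0 ** ?K) ** (partial c B x0 - B x0 ** ?\<omega>)
      = transpose (?K ** B x0) ** ((1/2) *\<^sub>R outer (ypart (\<alpha> x0)) ?p)"
    unfolding g2_C_K[OF x0] sckt_blocks(2)[OF x0, symmetric] by (rule matrix_mul_assoc[symmetric])
  ultimately have "g2 x0 ** endo_deriv g2 Jb c x0 = sym_prod (xpart (\<alpha> x0)) ?p
      - ((1/2) *\<^sub>R outer ?p (ypart (\<alpha> x0))) ** (?K ** B x0)
      - transpose (?K ** B x0) ** ((1/2) *\<^sub>R outer (ypart (\<alpha> x0)) ?p)"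
    by (simp only: sckt_blocks(3,4)[OF x0])
  also have "\<dots> = sym_prod (\<beta> x0) ?p"
    by (simp add: matrix_mult_scaleR_left matrix_mult_scaleR_right outer_matrix_mult matrix_mult_outer
        \<beta>_def) (simp add: sym_prod_def outer_def vec_eq_iff field_simps)
  finally show ?thesis .
qed

lemma smooth_Jb: "smooth_on S Jb"
proof -
  have sm: "smooth_on S A" "smooth_on S B" "smooth_on S C" "smooth_on S D"
    unfolding A_def B_def C_def D_def
    by (intro smooth_on_slice open_U smooth_on_bounded_linear[OF open_U _ smooth_J] bounded_linear_blocks)+
  then have "smooth_on S K"
    unfolding K_def by (intro smooth_on_matrix_inv open_S sm(1)) (simp add: A_def inv_J1)
  then have "smooth_on S (\<lambda>x. D x + (- 1) *\<^sub>R (C x ** K x ** B x))"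
    by (intro smooth_on_add smooth_on_matrix_mult smooth_on_bounded_linear[OF open_S bounded_linear_scaleR_right]
        open_S sm)
  then show ?thesis by (simp add: Jb_eq[abs_def])
qed

lemma \<beta>_eq: "x \<in> S \<Longrightarrow> \<beta> x = differential (\<lambda>w. trace (Jb w)) x"
  by (rule endo_deriv_eq_sym_prod_imp[OF riemannian_metric_slice])
    (simp_all add: endo_deriv_Jb smooth_on_imp_differentiable[OF smooth_Jb])

lemma sckt_Jb: "sckt_on S g2 Jb"
  unfolding sckt_on_iff[OF open_S riemannian_metric_slice]
  using smooth_Jb lowered_Jb_sym endo_deriv_Jb \<beta>_eq by simp

section \<open>The 1-form on the slice and the cofactor condition\<close>

lemma form_deriv_blocks:
  assumes "x \<in> S"
  shows "block21 (form_deriv g \<mu> (join y x)) = 0"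
    "block22 (form_deriv g \<mu> (join y x)) = form_deriv g2 (\<lambda>x. xpart (\<mu> (join y x))) x"
proof -
  let ?z = "join y x"
  have z: "?z \<in> U" using assms by simp
  note d = \<mu>_differentiable[OF z]
  \<comment> \<open>Row \<open>Inr c\<close> is the covariant derivative in the direction of x^c, so
    the two lower blocks involve only derivatives within the slice.\<close>
  have row: "block21 F $ c = ypart (F $ Inr c)" "block22 F $ c = xpart (F $ Inr c)"
    for F :: "real^('m + 'n)^('m + 'n)" and c
    by (simp_all add: block_defs ypart_def xpart_def vec_eq_iff)
  have diff: "ypart (a - b) = ypart a - ypart b" "xpart (a - b) = xpart a - xpart b"
    for a b :: "real^('m + 'n)"
    by (simp_all add: ypart_def xpart_def vec_eq_iff)
  note ds = bounded_linear_parts[THEN differentiable_bounded_linear, OF d]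
  have "ypart (partial (Inr c) \<mu> ?z) = partial c (\<lambda>x. ypart (\<mu> (join y x))) x" for c
    by (simp add: partial_slice[OF ds(1)] partial_bounded_linear[OF bounded_linear_parts(1) d])
  moreover have "partial c (\<lambda>x. ypart (\<mu> (join y x))) x = partial c (\<lambda>x. q) x" for c
    by (rule partial_cong_open[OF open_S assms]) (simp add: ypart_\<mu>)
  moreover have "xpart (partial (Inr c) \<mu> ?z) = partial c (\<lambda>x. xpart (\<mu> (join y x))) x" for c
    by (simp add: partial_slice[OF ds(2)] partial_bounded_linear[OF bounded_linear_parts(2) d])
  ultimately show "block21 (form_deriv g \<mu> ?z) = 0"
    "block22 (form_deriv g \<mu> ?z) = form_deriv g2 (\<lambda>x. xpart (\<mu> (join y x))) x"
    by (simp_all add: vec_eq_iff[where 'b='n] row form_deriv_def diff ypart_vector_matrix_mult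
        xpart_vector_matrix_mult conn_blocks[OF assms] partial_const)
qed

lemma reduced_equation:
  assumes "x \<in> S"
  defines "F \<equiv> form_deriv g2 (\<lambda>x. xpart (\<mu> (join y x))) x"
  shows "transpose (Jb x) ** F - transpose F ** Jb x = - (3/2) *\<^sub>R wedge (\<beta> x) (\<nu> x)"
proof -
  let ?z = "join y x"
  have z: "?z \<in> U" using assms by simp
  define M where "M = form_deriv g \<mu> ?z"
  define E :: "real^('m + 'n)^('m + 'n)" where
    "E = (\<chi> k l. case l of Inl _ \<Rightarrow> mat 1 $ k $ l
       | Inr b \<Rightarrow> (case k of Inl i \<Rightarrow> - (K x ** B x) $ i $ b | Inr _ \<Rightarrow> mat 1 $ k $ l))"
  have E: "block11 E = mat 1" "block12 E = - (K x ** B x)" "block21 E = 0" "block22 E = mat 1"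
    by (simp_all add: E_def block_defs vec_eq_iff mat_def)
  have JE: "block12 (J ?z ** E) = 0" "block22 (J ?z ** E) = Jb x"
    by (simp_all add: block_mult E Jb_eq matrix_mult_minus_right matrix_mul_assoc A_inv[OF assms(1)]
        A_def[symmetric] B_def[symmetric] C_def[symmetric] D_def[symmetric])
  have M: "block21 M = 0" "block22 M = F"
    unfolding M_def F_def by (rule form_deriv_blocks[OF assms(1)])+
  \<comment> \<open>The upper blocks of \<open>M\<close>, which contain y-derivatives, drop out:
    they would meet the vanishing (1,2) block of \<open>J E\<close>.\<close>
  have ME: "block22 (transpose (J ?z ** E) ** (M ** E)) = transpose (Jb x) ** F"
    by (simp add: block_mult(4)[of "transpose _"] block_mult(4)[of M] block_transpose JE M E
        matrix_mult_zero_left) (simp add: transpose_def matrix_matrix_mult_def vec_eq_iff)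
  have "transpose (J ?z) ** M - transpose M ** J ?z = - (3/2) *\<^sub>R wedge (\<alpha> x) (\<mu> ?z)"
    using DJ1_eq[OF open_U metric sckt z \<mu>_differentiable[OF z]] DJ1_\<mu>[OF z]
    by (simp add: M_def \<alpha>_def eq_neg_iff_add_eq_0)
  then have "transpose E ** (transpose (J ?z) ** M - transpose M ** J ?z) ** E
      = transpose E ** (- (3/2) *\<^sub>R wedge (\<alpha> x) (\<mu> ?z)) ** E" by simp
  then have "transpose (J ?z ** E) ** (M ** E) - transpose (transpose (J ?z ** E) ** (M ** E))
      = - (3/2) *\<^sub>R wedge (\<alpha> x v* E) (\<mu> ?z v* E)"
    by (simp only: matrix_mult_scaleR_left matrix_mult_scaleR_right wedge_congruence
        matrix_mult_diff_left matrix_mult_diff_right matrix_transpose_mul transpose_transpose matrix_mul_assoc)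
  from arg_cong[OF this, of block22]
  have "transpose (Jb x) ** F - transpose (transpose (Jb x) ** F)
      = block22 (- (3/2) *\<^sub>R wedge (\<alpha> x v* E) (\<mu> ?z v* E))"
    by (simp only: block_diff block_transpose ME)
  moreover have "block22 (a *\<^sub>R X) = a *\<^sub>R block22 X" "block22 (- X) = - block22 X" for a and X :: "real^('m + 'n)^('m + 'n)"
    by (simp_all add: block22_def vec_eq_iff)
  moreover have "v v* (- X) = - (v v* X)" for v and X :: "real^'n^'m"
    by (simp add: vector_matrix_mult_def vec_eq_iff sum_negf)
  ultimately show ?thesis
    using z by (simp add: matrix_transpose_mul block22_wedge xpart_vector_matrix_mult E \<beta>_def \<nu>_def ypart_\<mu>)
qed

text \<open>A constant \<open>c\<close> near \<open>x0\<close> suffices, since \<open>DJ1\<close> at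
  \<open>x0\<close> depends only on the germs there; \<open>c\<close> will be minus the value of
  \<open>d\<close> at \<open>x0\<close>.\<close>

lemma DJ1_scaled_\<nu>:
  assumes x0: "x0 \<in> S" and T: "open T" "x0 \<in> T" "T \<subseteq> S"
    and \<rho>: "\<And>x. x \<in> T \<Longrightarrow> \<rho> x = c *\<^sub>R \<nu> x"
  shows "DJ1 Jb \<rho> x0 = 0"
proof -
  let ?m = "\<lambda>x. xpart (\<mu> (join y x))" and ?k = "K x0"
  obtain T' where T': "open T'" "x0 \<in> T'" "T' \<subseteq> S" "\<And>x. x \<in> T' \<Longrightarrow> A x = A x0"
    using A_locally_constant[OF x0] by blast
  \<comment> \<open>With the inverse block frozen, the second term of
    \<open>c *\<^sub>R \<nu>\<close> is a fixed linear map applied to \<open>B\<close>, and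
    differentiation passes through it.\<close>
  define L :: "real^'n^'m \<Rightarrow> real^'n" where "L X = c *\<^sub>R (q v* (?k ** X))" for X
  have L: "bounded_linear L"
    unfolding linear_conv_bounded_linear[symmetric] L_def
    by (rule linearI) (simp_all add: vec_eq_iff vector_matrix_mult_def matrix_matrix_mult_def
        sum.distrib sum_distrib_left algebra_simps)
  have m: "?m differentiable (at x0)"
    using x0 by (intro differentiable_slice
        differentiable_bounded_linear[OF bounded_linear_parts(2)] \<mu>_differentiable) simp
  note Ld = differentiable_bounded_linear[OF L blocks_differentiable(2)[OF x0]]
  note md = differentiable_bounded_linear[OF bounded_linear_scaleR_right m, of c]
  have eq: "\<rho> x = c *\<^sub>R ?m x - L (B x)" if "x \<in> T \<inter> T'" for x
    using that \<rho>[of x] T'(4)[of x] by (simp add: \<nu>_def L_def K_def algebra_simps)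
  have op: "open (T \<inter> T')" "x0 \<in> T \<inter> T'" using T T' by auto
  have \<rho>d: "\<rho> differentiable (at x0)"
    using differentiable_diff[OF md Ld] differentiable_cong_open[OF op eq] by simp
  have "partial l \<rho> x0 = partial l (\<lambda>x. c *\<^sub>R ?m x - L (B x)) x0" for l
    using op eq by (rule partial_cong_open)
  then have d: "partial l \<rho> x0 = c *\<^sub>R partial l ?m x0 - L (partial l B x0)" for l
    by (simp add: partial_diff[OF md Ld] partial_bounded_linear[OF L blocks_differentiable(2)[OF x0]]
        partial_bounded_linear[OF bounded_linear_scaleR_right m])
  \<comment> \<open>The factor left when \<open>L\<close> meets the derivative equation of
    \<open>B\<close>: the outer product there reduces to a multiple of the metric column.\<close>
  define s where "s = c * ((q v* ?k v* matrix_inv (g1 y)) \<bullet> ypart (\<alpha> x0)) / 2"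
  have LB: "L (partial l B x0 - B x0 ** conn g2 l x0) = s *\<^sub>R column l (g2 x0)" for l
  proof -
    let ?X = "partial l B x0 - B x0 ** conn g2 l x0"
    have "?X = matrix_inv (g1 y) ** (g1 y ** ?X)"
      using g1_invertible[OF x0] by (simp only: matrix_mul_assoc matrix_inv_left matrix_mul_lid)
    then have "L ?X = c *\<^sub>R ((q v* ?k v* matrix_inv (g1 y)) v* ((1/2) *\<^sub>R outer (ypart (\<alpha> x0)) (column l (g2 x0))))"
      unfolding L_def vector_matrix_mul_assoc sckt_blocks(2)[OF x0] by (metis matrix_mul_assoc)
    moreover have "v v* (a *\<^sub>R X) = a *\<^sub>R (v v* X)" for v a and X :: "real^'n^'m"
      by (simp add: vector_matrix_mult_def vec_eq_iff sum_distrib_left mult_ac)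
    ultimately show ?thesis by (simp add: s_def vector_matrix_mult_outer)
  qed
  have "form_deriv g2 \<rho> x0 $ l = (c *\<^sub>R form_deriv g2 ?m x0 - s *\<^sub>R g2 x0) $ l" for l
  proof -
    have "column l (g2 x0) = g2 x0 $ l"
      using riemannian_metric_sym[OF riemannian_metric_slice x0] by (simp add: column_def vec_eq_iff)
    moreover have "L (partial l B x0) - L (B x0) v* conn g2 l x0 = L (partial l B x0 - B x0 ** conn g2 l x0)"
      by (simp add: bounded_linear.linear[OF L, THEN linear_diff])
        (simp add: L_def vector_matrix_mul_assoc matrix_mul_assoc scaleR_vector_matrix_assoc[symmetric])
    ultimately show ?thesis
      using LB[of l] op(2)
      by (simp add: form_deriv_def d eq algebra_simps scaleR_vector_matrix_assoc[symmetric])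
  qed
  then have F: "form_deriv g2 \<rho> x0 = c *\<^sub>R form_deriv g2 ?m x0 - s *\<^sub>R g2 x0"
    by (simp add: vec_eq_iff[of "form_deriv g2 \<rho> x0"])
  have "transpose (Jb x0) ** g2 x0 = g2 x0 ** Jb x0"
    using lowered_Jb_sym[OF x0] by (simp add: matrix_transpose_mul g2_sym[OF x0])
  moreover have "transpose (a *\<^sub>R X - b *\<^sub>R Y) = a *\<^sub>R transpose X - b *\<^sub>R transpose Y"
    for a b and X Y :: "real^'n^'n"
    by (simp add: transpose_def vec_eq_iff)
  \<comment> \<open>The multiple \<open>s\<close> of \<open>g2\<close> cancels here because
    \<open>g2 x0 ** Jb x0\<close> is symmetric.\<close>
  ultimately have "transpose (Jb x0) ** form_deriv g2 \<rho> x0 - transpose (form_deriv g2 \<rho> x0) ** Jb x0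
      = c *\<^sub>R (transpose (Jb x0) ** form_deriv g2 ?m x0 - transpose (form_deriv g2 ?m x0) ** Jb x0)"
    by (simp add: F matrix_mult_diff_left matrix_mult_diff_right matrix_mult_scaleR_left
        matrix_mult_scaleR_right g2_sym[OF x0] scaleR_diff_right)
  also have "\<dots> = - (3/2) *\<^sub>R wedge (\<beta> x0) (\<rho> x0)"
    using \<rho>[OF T(2)] by (simp add: reduced_equation[OF x0] wedge_scaleR_right)
  finally show ?thesis
    by (simp add: DJ1_eq[OF open_S riemannian_metric_slice sckt_Jb x0 \<rho>d] \<beta>_eq[OF x0])
qed

lemma cofactor_system_slice:
  assumes W: "smooth_on U W"
    and dW: "\<And>z. z \<in> U \<Longrightarrow> \<mu> z v* cof_coeff CARD('n) (J z) = - differential W z"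
  shows "cofactor_system S g2 (\<lambda>x. xpart (differential W (join y x))) Jb"
proof -
  let ?\<rho> = "\<lambda>x. xpart (differential W (join y x))"
  let ?d = "\<lambda>x. coeff (det (pencil (J (join y x)))) CARD('n)"
  \<comment> \<open>The last block column of \<open>A_(n)\<close> sends \<mu> to \<open>d\<close>
    times \<nu>; the minus sign is that of \<open>A_(n) \<mu> = -dW_(n)\<close>.\<close>
  have \<rho>: "?\<rho> x = - ?d x *\<^sub>R \<nu> x" if "x \<in> S" for x
  proof -
    have z: "join y x \<in> U" using that by simp
    have "?\<rho> x = - xpart (\<mu> (join y x) v* cof_coeff CARD('n) (J (join y x)))"
      by (simp add: dW[OF z]) (simp add: xpart_def vec_eq_iff)
    also have "\<dots> = - (q v* (- (?d x *\<^sub>R (K x ** B x))) + xpart (\<mu> (join y x)) v* mat (?d x))"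
      by (simp add: xpart_vector_matrix_mult cof_coeff_card[OF inv_J1[OF z]] ypart_\<mu>[OF z] K_def A_def B_def)
    also have "\<dots> = - ?d x *\<^sub>R \<nu> x"
      by (simp add: \<nu>_def vec_eq_iff vector_matrix_mult_def mat_def sum_negf sum_distrib_left
          if_distrib[of "\<lambda>c. _ * c"] if_distrib[of "\<lambda>c. c * _"] algebra_simps cong: if_cong)
    finally show ?thesis .
  qed
  have "DJ1 Jb ?\<rho> x0 = 0" if x0: "x0 \<in> S" for x0
  proof -
    obtain T where T: "open T" "x0 \<in> T" "T \<subseteq> S" "\<And>x. x \<in> T \<Longrightarrow> A x = A x0"
      using A_locally_constant[OF x0] by blast
    \<comment> \<open>The factor depends on \<open>J\<close> only through \<open>J_1\<close>, which
      is constant on \<open>T\<close>.\<close>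
    have "?d x = ?d x0" if "x \<in> T" for x
      by (rule coeff_det_pencil_cong) (use T(4)[OF that] in \<open>simp add: A_def\<close>)
    then have "?\<rho> x = - ?d x0 *\<^sub>R \<nu> x" if "x \<in> T" for x
      using \<rho> that T(3) by (metis subsetD)
    then show ?thesis by (rule DJ1_scaled_\<nu>[OF x0 T(1-3)])
  qed
  moreover have "smooth_on S ?\<rho>"
  proof (rule smooth_on_vec[OF open_S])
    fix a
    have "smooth_on S (\<lambda>x. partial (Inr a) W (join y x))"
      by (rule smooth_on_slice[OF open_U smooth_on_partial[OF W]])
    then show "smooth_on S (\<lambda>x. ?\<rho> x $ a)" by (simp add: xpart_def differential_def)
  qed
  moreover have "invertible (Jb x)" if "x \<in> S" for x
    unfolding Jb_def using that by (intro invertible_Jbar2 inv_J inv_J1) simp_all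
  ultimately show ?thesis
    unfolding cofactor_system_def using open_S riemannian_metric_slice sckt_Jb by blast
qed

end

theorem proposition2:
  fixes U :: "(real^('m::finite + 'n::finite)) set"
    and g :: "real^('m + 'n) \<Rightarrow> real^('m + 'n)^('m + 'n)"
    and g1 :: "real^'m \<Rightarrow> real^'m^'m"
    and g2 :: "real^'n \<Rightarrow> real^'n^'n"
    and \<mu> :: "real^('m + 'n) \<Rightarrow> real^('m + 'n)"
    and J :: "real^('m + 'n) \<Rightarrow> real^('m + 'n)^('m + 'n)"
    and W :: "real^('m + 'n) \<Rightarrow> real"
    and y :: "real^'m"
  assumes "driven_cofactor_system U g g1 g2 \<mu> J"
    and "\<And>z. z \<in> U \<Longrightarrow> invertible (block11 (J z))"
    and "smooth_on U W"
    and "\<And>z. z \<in> U \<Longrightarrow> \<mu> z v* cof_coeff CARD('n) (J z) = - differential W z"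
  shows "cofactor_system {x. join y x \<in> U} g2
           (\<lambda>x. xpart (differential W (join y x)))
           (\<lambda>x. Jbar2 (J (join y x)))"
proof -
  obtain Q where Q: "\<And>z. z \<in> U \<Longrightarrow> ypart (\<mu> z) = Q (ypart z)"
    using assms(1) unfolding driven_cofactor_system_def by blast
  \<comment> \<open>All points \<open>join y x\<close> have the same y-part, so \<open>Q y\<close>
    serves as the constant \<open>q\<close>.\<close>
  interpret driven_slice U g g1 g2 \<mu> J y "Q y"
    by unfold_locales (use assms(1,2) Q in \<open>auto simp: driven_cofactor_system_def\<close>)
  show ?thesis
    using cofactor_system_slice[OF assms(3,4)] by (simp add: Jb_def[abs_def])
qed

end
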